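(* Suppose that Assumptions (A1)-(A4) of the context hold, that $\hat z$ is generated by $$\dot{\hat z}=\Phi(z+\beta_0)\nabla h(x)\big(Y(x)\hat\theta+f(x)+g(x)u\big)+\gamma(z-\hat z),\qquad \gamma>0,$$ that $\hat\theta$ is generated by $\dot{\hat\theta}=\operatorname{proj}_\Theta(\hat\theta,\Gamma\phi)$ with $\Gamma$ and $\phi$ as in the context, and that the gains are selected such that $$\frac{\beta_\theta}{k_\theta\overline\Gamma}>\underline\sigma_\theta.$$ Then the error system $$\dot{\tilde z}=\Phi(z+\beta_0)\nabla h(x)Y(x)\tilde\theta-\gamma\tilde z,\qquad \dot{\tilde\theta}=-\operatorname{proj}_\Theta\Big(\hat\theta,\;k_\theta\Gamma\Sigma_{\mathcal{Y}}\tilde\theta+\Gamma Y(x)^\top\nabla h(x)^\top\Phi(z+\beta_0)\tilde z\Big),$$ with $\tilde z:=z-\hat z$ and $\tilde\theta:=\theta-\hat\theta$, is exponentially stable (at the origin $(\tilde z,\tilde\theta)=(0,0)$).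
   Context: **Plant.** $\dot x=Y(x)\theta+f(x)+g(x)u$, $x(0)=x_0$, with $x\in\mathbb{R}^n$, $u\in\mathbb{R}^m$, unknown constant $\theta\in\mathbb{R}^p$, and known $Y:\mathbb{R}^n\to\mathbb{R}^{n\times p}$, $f:\mathbb{R}^n\to\mathbb{R}^n$, $g:\mathbb{R}^n\to\mathbb{R}^{n\times m}$. **Safe set and barrier state.** $h\in\mathcal{C}^1(\mathbb{R}^n;\mathbb{R})$, $\mathcal{S}=\{x:h(x)\ge0\}$, $\partial\mathcal{S}=\{x:h(x)=0\}$, $\operatorname{int}(\mathcal{S})=\{x:h(x)>0\}$; $\nabla h(x)$ is a row vector. $B\in\mathcal{C}^\infty((0,\infty);\mathbb{R})$ satisfies $\frac{dB(a)}{da}<0$ for $a>0$, $\lim_{a\to0^+}B(a)=\infty$, and $\Phi:=\frac{dB}{da}\circ B^{-1}\in\mathcal{C}^\infty((0,\infty);\mathbb{R})$. Put $\beta(x)=B(h(x))$, $\beta_0=\beta(0)$ (finite), and define the barrier state $z=\beta(x)-\beta_0$, which satisfies $\dot z=\Phi(z+\beta_0)\nabla h(x)(Y(x)\theta+f(x)+g(x)u)$. All time-varying signals $x,z,u$ are taken along a trajectory of this system. **Integral concurrent learning data.** For a fixed delay $T>0$ and $t\ge T$: $\mathcal{X}(t)=x(t)-x(t-T)$, $\mathcal{Y}(t)=\int_{t-T}^tY(x(\tau))d\tau$, $\mathcal{G}_{fu}(t)=\int_{t-T}^t(f(x(\tau))+g(x(\tau))u(\tau))d\tau$, so that $\mathcal{X}(t)=\mathcal{Y}(t)\theta+\mathcal{G}_{fu}(t)$.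 A history stack stores $N$ samples $(\mathcal{X}_i,\mathcal{Y}_i,\mathcal{G}_{fu,i})$ taken at times $t_i$. With $\kappa>0$, let $\Sigma_{\mathcal{Y}}=\sum_{i=1}^N\frac{\mathcal{Y}_i^\top\mathcal{Y}_i}{1+\kappa\|\mathcal{Y}_i\|^2}$. An old sample is replaced by a new one only if the replacement increases $\lambda_{\min}(\Sigma_{\mathcal{Y}})$ by a factor larger than $1+\delta$, for a fixed $\delta>0$ (so $\lambda_{\min}(\Sigma_{\mathcal{Y}})$ is non-decreasing in time). **Projection.** $\Theta=\{\vartheta\in\mathbb{R}^p:\|\vartheta\|\le\overline\theta\}$; $\operatorname{proj}_\Theta(\mu,v)=\big(I_p-\frac{\Gamma\mu\mu^\top}{\mu^\top\Gamma\mu}\big)v$ if $\mu\in\partial\Theta$ and $\mu^\top v>0$, and $\operatorname{proj}_\Theta(\mu,v)=v$ otherwise. **Update quantities.** Gains $k_\theta,\beta_\theta>0$; $$\phi=Y(x)^\top\nabla h(x)^\top\Phi(z+\beta_0)\tilde z+k_\theta\sum_{i=1}^N\frac{\mathcal{Y}_i^\top(\mathcal{X}_i-\mathcal{G}_{fu,i}-\mathcal{Y}_i\hat\theta)}{1+\kappa\|\mathcal{Y}_i\|^2}.$$ The matrix $\Gamma(t)\in\mathbb{R}^{p\times p}$ satisfies $\dot\Gamma=\beta_\theta\Gamma-k_\theta\Gamma\Sigma_{\mathcal{Y}}\Gamma$ if $\hat\theta\in\operatorname{int}(\Theta)$ or ($\hat\theta\in\partial\Theta$ and $(\Gamma\phi)^\top\hat\theta\le0$),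 and $\dot\Gamma=0$ otherwise. It is symmetric positive definite, with constants $0<\underline\Gamma\le\overline\Gamma$ such that $\underline\Gamma I_p\preceq\Gamma(t)\preceq\overline\Gamma I_p$ for all $t\ge0$. **Assumptions.** (A1) $f,g,Y$ are locally Lipschitz, $f(0)=0$, $Y(0)=0$, and $0<\|g(x)\|\le\overline G$ for some $\overline G>0$ and all $x\in\mathbb{R}^n$. (A2) $\|\theta\|\le\overline\theta$ for a known $\overline\theta>0$. (A3) $\mathcal{S}$ is nonempty, has no isolated points, and $\nabla h(x)\ne0$ for all $x\in\partial\mathcal{S}$. (A4) There is a finite collection of sampling instants $\{t_i\}_{i=1}^N$ such that $\lambda_{\min}(\Sigma_{\mathcal{Y}})=:\underline\sigma_\theta>0$. *)

theory Defs
  imports "HOL-Analysis.Analysis"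
begin

definition matrix_norm :: "real^'a^'b \<Rightarrow> real" where
  "matrix_norm A = onorm (\<lambda>v. A *v v)"

definition lambda_min :: "real^'a^'a \<Rightarrow> real" where
  "lambda_min A = Min {c. \<exists>v. v \<noteq> 0 \<and> A *v v = c *\<^sub>R v}"

definition pos_semidef :: "real^'a^'a \<Rightarrow> bool" where
  "pos_semidef A \<longleftrightarrow> transpose A = A \<and> (\<forall>v. 0 \<le> v \<bullet> (A *v v))"

definition loewner_le :: "real^'a^'a \<Rightarrow> real^'a^'a \<Rightarrow> bool" where
  "loewner_le A C \<longleftrightarrow> pos_semidef (C - A)"

text \<open>The gradient as a column vector: the row vector \<open>\<nabla>h(x)\<close> applied to \<open>v\<close> is
  \<open>gradient h x \<bullet> v\<close>.\<close>

definition gradient :: "(real^'n \<Rightarrow> real) \<Rightarrow> real^'n \<Rightarrow> real^'n" where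
  "gradient h x = (THE D. GDERIV h x :> D)"

definition C1_function :: "(real^'n \<Rightarrow> real) \<Rightarrow> bool" where
  "C1_function h \<longleftrightarrow> (\<forall>x. h differentiable (at x)) \<and> continuous_on UNIV (gradient h)"

text \<open>Class \<open>C\<^sup>\<infinity>\<close> on an open set of reals.\<close>

definition smooth_on :: "real set \<Rightarrow> (real \<Rightarrow> real) \<Rightarrow> bool" where
  "smooth_on S f \<longleftrightarrow> (\<forall>k. \<forall>a\<in>S. (deriv ^^ k) f field_differentiable (at a))"

definition locally_lipschitz :: "('a::metric_space \<Rightarrow> 'b::metric_space) \<Rightarrow> bool" where
  "locally_lipschitz F \<longleftrightarrow> local_lipschitz (UNIV :: real set) UNIV (\<lambda>_. F)"

definition barrier_Phi :: "(real \<Rightarrow> real) \<Rightarrow> real \<Rightarrow> real" where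
  "barrier_Phi B = deriv B \<circ> inv_into {0<..} B"

text \<open>The inclusion \<open>{0<..} \<subseteq> B ` {0<..}\<close> says that \<open>B\<^sup>-\<^sup>1\<close>, and with it \<open>barrier_Phi B\<close>,
  is defined on \<open>(0,\<infinity>)\<close>; outside of the range of \<open>B\<close> the value of \<open>inv_into\<close> is arbitrary.\<close>

definition barrier_function :: "(real \<Rightarrow> real) \<Rightarrow> bool" where
  "barrier_function B \<longleftrightarrow>
     smooth_on {0<..} B \<and> (\<forall>a>0. deriv B a < 0) \<and> filterlim B at_top (at_right 0) \<and>
     {0<..} \<subseteq> B ` {0<..} \<and> smooth_on {0<..} (barrier_Phi B)"

text \<open>The right-hand sides below are discontinuous in the state (projection) and in time (sample
  replacement), so solutions are meant in the sense of Caratheodory: absolutely continuous on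
  compact intervals, satisfying the equation almost everywhere.\<close>

definition abs_continuous_on :: "real set \<Rightarrow> (real \<Rightarrow> 'a::real_normed_vector) \<Rightarrow> bool" where
  "abs_continuous_on I y \<longleftrightarrow>
     (\<forall>\<epsilon>>0. \<exists>\<delta>>0. \<forall>d S. d division_of S \<and> S \<subseteq> I \<and> (\<Sum>k\<in>d. Sup k - Inf k) < \<delta> \<longrightarrow>
        (\<Sum>k\<in>d. norm (y (Sup k) - y (Inf k))) < \<epsilon>)"

definition caratheodory_solution ::
    "real \<Rightarrow> (real \<Rightarrow> 'a \<Rightarrow> 'a) \<Rightarrow> (real \<Rightarrow> 'a::real_normed_vector) \<Rightarrow> bool" where
  "caratheodory_solution t0 F y \<longleftrightarrow>
     (\<forall>b\<ge>t0. abs_continuous_on {t0..b} y) \<and>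
     (AE t in lborel. t > t0 \<longrightarrow> (y has_vector_derivative F t (y t)) (at t))"

text \<open>Exponential stability of the origin of the nonautonomous system
  \<open>y' = F (M t) t y\<close>, uniformly in the initial time \<open>t0 \<ge> 0\<close> and in the initial state from some
  ball. The auxiliary signal \<open>M\<close> ranges over those admitted by \<open>aux t0 M y\<close>.\<close>

definition exponentially_stable ::
    "('g \<Rightarrow> real \<Rightarrow> 'a \<Rightarrow> 'a) \<Rightarrow>
     (real \<Rightarrow> (real \<Rightarrow> 'g) \<Rightarrow> (real \<Rightarrow> 'a::real_normed_vector) \<Rightarrow> bool) \<Rightarrow> bool" where
  "exponentially_stable F aux \<longleftrightarrow>
     (\<forall>t\<ge>0. \<forall>G. F G t 0 = 0) \<and>
     (\<exists>c>0. \<exists>K>0. \<exists>r>0. \<forall>t0\<ge>0. \<forall>M y.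
        caratheodory_solution t0 (\<lambda>t. F (M t) t) y \<and> aux t0 M y \<and> norm (y t0) < c \<longrightarrow>
        (\<forall>t\<ge>t0. norm (y t) \<le> K * norm (y t0) * exp (- r * (t - t0))))"

text \<open>\<open>stack t i\<close> is the sampling instant of the sample held in slot \<open>i \<in> {1..slots}\<close> at time
  \<open>t\<close>, or \<open>None\<close> while that slot has not been filled yet.\<close>

record ('n::finite, 'm::finite, 'p::finite) adaptive_system =
  pY :: "real^'n \<Rightarrow> real^'p^'n"
  pf :: "real^'n \<Rightarrow> real^'n"
  pg :: "real^'n \<Rightarrow> real^'m^'n"
  theta :: "real^'p"
  theta_bar :: real
  hfun :: "real^'n \<Rightarrow> real"
  barB :: "real \<Rightarrow> real"
  xsig :: "real \<Rightarrow> real^'n"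
  usig :: "real \<Rightarrow> real^'m"
  delay :: real
  kappa :: real
  delta :: real
  slots :: nat
  stack :: "real \<Rightarrow> nat \<Rightarrow> real option"
  k_theta :: real
  beta_theta :: real
  gamma :: real
  Gamma_lo :: real
  Gamma_hi :: real

definition safe_set :: "(real^'n \<Rightarrow> real) \<Rightarrow> (real^'n) set" where
  "safe_set h = {x. h x \<ge> 0}"

definition safe_boundary :: "(real^'n \<Rightarrow> real) \<Rightarrow> (real^'n) set" where
  "safe_boundary h = {x. h x = 0}"

definition safe_interior :: "(real^'n \<Rightarrow> real) \<Rightarrow> (real^'n) set" where
  "safe_interior h = {x. h x > 0}"

text \<open>The barrier state \<open>B (h x) - B (h 0)\<close> exists only as long as the trajectory is in the
  interior of the safe set.\<close>

definition plant_trajectory :: "('n::finite, 'm::finite, 'p::finite) adaptive_system \<Rightarrow> bool" where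
  "plant_trajectory D \<longleftrightarrow>
     caratheodory_solution 0 (\<lambda>t x. pY D x *v theta D + pf D x + pg D x *v usig D t) (xsig D) \<and>
     (\<forall>t\<ge>0. xsig D t \<in> safe_interior (hfun D))"

definition beta0 :: "('n::finite, 'm::finite, 'p::finite) adaptive_system \<Rightarrow> real" where
  "beta0 D = barB D (hfun D 0)"

definition zsig :: "('n::finite, 'm::finite, 'p::finite) adaptive_system \<Rightarrow> real \<Rightarrow> real" where
  "zsig D t = barB D (hfun D (xsig D t)) - beta0 D"

text \<open>\<open>\<Phi>(z + \<beta>\<^sub>0)\<close> along the trajectory\<close>

definition Phi_z :: "('n::finite, 'm::finite, 'p::finite) adaptive_system \<Rightarrow> real \<Rightarrow> real" where
  "Phi_z D t = barrier_Phi (barB D) (zsig D t + beta0 D)"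

definition X_data :: "('n::finite, 'm::finite, 'p::finite) adaptive_system \<Rightarrow> real \<Rightarrow> real^'n" where
  "X_data D t = xsig D t - xsig D (t - delay D)"

definition Y_data :: "('n::finite, 'm::finite, 'p::finite) adaptive_system \<Rightarrow> real \<Rightarrow> real^'p^'n" where
  "Y_data D t = integral {t - delay D..t} (\<lambda>\<tau>. pY D (xsig D \<tau>))"

definition G_data :: "('n::finite, 'm::finite, 'p::finite) adaptive_system \<Rightarrow> real \<Rightarrow> real^'n" where
  "G_data D t = integral {t - delay D..t} (\<lambda>\<tau>. pf D (xsig D \<tau>) + pg D (xsig D \<tau>) *v usig D \<tau>)"

definition filled :: "('n::finite, 'm::finite, 'p::finite) adaptive_system \<Rightarrow> real \<Rightarrow> nat set" where
  "filled D t = {i\<in>{1..slots D}. stack D t i \<noteq> None}"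

definition instant :: "('n::finite, 'm::finite, 'p::finite) adaptive_system \<Rightarrow> real \<Rightarrow> nat \<Rightarrow> real" where
  "instant D t i = the (stack D t i)"

definition Sigma_Y :: "('n::finite, 'm::finite, 'p::finite) adaptive_system \<Rightarrow> real \<Rightarrow> real^'p^'p" where
  "Sigma_Y D t = (\<Sum>i\<in>filled D t. let Yi = Y_data D (instant D t i) in
     (1 / (1 + kappa D * (matrix_norm Yi)\<^sup>2)) *\<^sub>R (transpose Yi ** Yi))"

text \<open>Empty slots may be filled freely; between any two times at which the content of an occupied
  slot differs, the smallest eigenvalue has grown by a factor larger than \<open>1 + \<delta>\<close>. Sampling
  instants later than \<open>t\<close> are not excluded, so a stack that is full from time 0 on is covered.\<close>

definition history_stack :: "('n::finite, 'm::finite, 'p::finite) adaptive_system \<Rightarrow> bool" where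
  "history_stack D \<longleftrightarrow>
     (\<forall>t\<ge>0. \<forall>i\<in>filled D t. instant D t i \<ge> delay D) \<and>
     (\<forall>t\<ge>0. \<forall>t'>t. filled D t \<subseteq> filled D t' \<and>
        ((\<exists>i\<in>filled D t. instant D t' i \<noteq> instant D t i) \<longrightarrow>
           lambda_min (Sigma_Y D t') > (1 + delta D) * lambda_min (Sigma_Y D t)))"

definition Theta :: "('n::finite, 'm::finite, 'p::finite) adaptive_system \<Rightarrow> (real^'p) set" where
  "Theta D = {v. norm v \<le> theta_bar D}"

definition proj :: "real^'p^'p \<Rightarrow> (real^'p) set \<Rightarrow> real^'p \<Rightarrow> real^'p \<Rightarrow> real^'p" where
  "proj G T \<mu> v =
     (if \<mu> \<in> frontier T \<and> \<mu> \<bullet> v > 0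
      then (mat 1 - (1 / (\<mu> \<bullet> (G *v \<mu>))) *\<^sub>R
              (G ** (columnvector \<mu> :: real^1^'p) ** rowvector \<mu>)) *v v
      else v)"

text \<open>\<open>\<phi>\<close> at time \<open>t\<close>, as a function of the error \<open>zt\<close> of the barrier state and of the parameter
  estimate \<open>th\<close>\<close>

definition phi :: "('n::finite, 'm::finite, 'p::finite) adaptive_system \<Rightarrow> real \<Rightarrow> real \<Rightarrow> real^'p \<Rightarrow> real^'p"
  where
  "phi D t zt th =
     (Phi_z D t * zt) *\<^sub>R (transpose (pY D (xsig D t)) *v gradient (hfun D) (xsig D t)) +
     k_theta D *\<^sub>R (\<Sum>i\<in>filled D t. let r = instant D t i; Yi = Y_data D r in
       (1 / (1 + kappa D * (matrix_norm Yi)\<^sup>2)) *\<^sub>R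
         (transpose Yi *v (X_data D r - G_data D r - Yi *v th)))"

definition Gamma_rhs :: "('n::finite, 'm::finite, 'p::finite) adaptive_system \<Rightarrow>
    (real \<Rightarrow> real) \<Rightarrow> (real \<Rightarrow> real^'p) \<Rightarrow> real \<Rightarrow> real^'p^'p \<Rightarrow> real^'p^'p" where
  "Gamma_rhs D zt th t G =
     (if th t \<in> interior (Theta D) \<or>
         (th t \<in> frontier (Theta D) \<and> (G *v phi D t (zt t) (th t)) \<bullet> th t \<le> 0)
      then beta_theta D *\<^sub>R G - k_theta D *\<^sub>R (G ** Sigma_Y D t ** G)
      else 0)"

definition Gamma_gain :: "('n::finite, 'm::finite, 'p::finite) adaptive_system \<Rightarrow> real \<Rightarrow>
    (real \<Rightarrow> real) \<Rightarrow> (real \<Rightarrow> real^'p) \<Rightarrow> (real \<Rightarrow> real^'p^'p) \<Rightarrow> bool" where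
  "Gamma_gain D t0 zt th G \<longleftrightarrow>
     caratheodory_solution t0 (Gamma_rhs D zt th) G \<and>
     (\<forall>t\<ge>t0. transpose (G t) = G t \<and>
        loewner_le (mat (Gamma_lo D)) (G t) \<and> loewner_le (G t) (mat (Gamma_hi D)))"

definition zhat_rhs :: "('n::finite, 'm::finite, 'p::finite) adaptive_system \<Rightarrow>
    (real \<Rightarrow> real^'p) \<Rightarrow> real \<Rightarrow> real \<Rightarrow> real" where
  "zhat_rhs D th t zh =
     Phi_z D t * (gradient (hfun D) (xsig D t) \<bullet>
       (pY D (xsig D t) *v th t + pf D (xsig D t) + pg D (xsig D t) *v usig D t)) +
     gamma D * (zsig D t - zh)"

definition thetahat_rhs :: "('n::finite, 'm::finite, 'p::finite) adaptive_system \<Rightarrow>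
    (real \<Rightarrow> real) \<Rightarrow> (real \<Rightarrow> real^'p^'p) \<Rightarrow> real \<Rightarrow> real^'p \<Rightarrow> real^'p" where
  "thetahat_rhs D zt G t th = proj (G t) (Theta D) th (G t *v phi D t (zt t) th)"

definition error_rhs :: "('n::finite, 'm::finite, 'p::finite) adaptive_system \<Rightarrow>
    real^'p^'p \<Rightarrow> real \<Rightarrow> real \<times> (real^'p) \<Rightarrow> real \<times> (real^'p)" where
  "error_rhs D G t e = (case e of (zt, tht) \<Rightarrow>
     (Phi_z D t * (gradient (hfun D) (xsig D t) \<bullet> (pY D (xsig D t) *v tht)) - gamma D * zt,
      - proj G (Theta D) (theta D - tht)
          (k_theta D *\<^sub>R (G *v (Sigma_Y D t *v tht)) +
           (Phi_z D t * zt) *\<^sub>R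
             (G *v (transpose (pY D (xsig D t)) *v gradient (hfun D) (xsig D t))))))"

end

theory Submission
  imports Defs
begin

text \<open>The Lyapunov function is \<open>V = z\<^sup>2 + e \<bullet> \<Gamma>\<^sup>-\<^sup>1 e\<close> with \<open>z\<close>, \<open>e\<close> the errors of the barrier state and of
  the parameter. Along almost every time the barrier coupling terms cancel, the projection only
  decreases \<open>V\<close>, and the dynamics of \<open>\<Gamma>\<close> costs at most half of the concurrent learning term,
  whether or not they are switched off, so \<open>V' \<le> - 2 \<gamma> z\<^sup>2 - k e \<bullet> \<Sigma> e\<close>. Hence \<open>V\<close> never increases, and it
  decays exponentially from the time \<open>t1\<close> on at which the history stack is full, since
  \<open>\<lambda>\<^sub>m\<^sub>i\<^sub>n(\<Sigma>)\<close> cannot fall afterwards. That solutions are only absolutely continuous is dealt with by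
  the fundamental theorem of calculus for absolutely continuous functions.\<close>

subsection \<open>Absolutely continuous functions\<close>

text \<open>The gain dynamics costs only half of the learning term because the derivative of
  \<open>Gamma\<close>^-1 is - \<open>Gamma\<close>^-1 \<open>Gamma\<close>'
  \<open>Gamma\<close>^-1. With the update on this equals k \<open>Sigma\<close> - beta
  \<open>Gamma\<close>^-1, with it off it is 0, so its share of V' is at most k e .
  \<open>Sigma\<close> e, against -2 k e . \<open>Sigma\<close> e from the learning law. The inverse
  itself is never formed: a vector \<open>w t\<close> with \<open>G t *v w t\<close> equal to the
  parameter error stands in for it, and coercivity of \<open>G t\<close> gives its existence and
  carries absolute continuity and derivatives over to it. What shapes the proof is that projection,
  gain update and stack all switch at times about which nothing is known, so no interval of
  smoothness can be singled out: every estimate is made at a single time where the derivatives exist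
  and is then integrated. The instant \<open>t1\<close> is fixed by the data and not by the initial
  time, which keeps the stability constants uniform.\<close>

lemma division_interval_real:
  fixes d :: "real set set"
  assumes "d division_of S" "k \<in> d"
  obtains u v where "u \<le> v" "k = {u..v}" "Inf k = u" "Sup k = v" "u \<in> S" "v \<in> S"
proof -
  obtain u v where k: "k = cbox u v" and ne: "k \<noteq> {}"
    using division_ofD(3,4)[OF assms] by blast
  have "u \<le> v" using k ne by auto
  moreover have "k \<subseteq> S" using division_ofD(2)[OF assms] .
  ultimately show thesis using that[of u v] k by (auto simp: subset_iff)
qed

text \<open>Absolute continuity sees nothing but increments, so a bound on increments transfers it.
  Products, compositions and solutions of linear systems below all come down to this, applied to a
  pair when two functions are combined.\<close>

lemma abs_continuous_on_dominated:
  fixes y :: "real \<Rightarrow> 'a::real_normed_vector" and w :: "real \<Rightarrow> 'b::real_normed_vector"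
  assumes y: "abs_continuous_on I y"
    and dom: "\<And>s t. s \<in> I \<Longrightarrow> t \<in> I \<Longrightarrow> norm (w s - w t) \<le> L * norm (y s - y t)"
  shows "abs_continuous_on I w"
  unfolding abs_continuous_on_def
proof (intro allI impI)
  fix \<epsilon> :: real assume \<epsilon>: "\<epsilon> > 0"
  \<comment> \<open>\<open>L\<close> may be 0 or negative; dividing by it requires a positive
    replacement.\<close>
  define M where "M = max L 1"
  have M: "M > 0" "L \<le> M" by (auto simp: M_def)
  obtain \<delta> where \<delta>: "\<delta> > 0" "\<And>d S. d division_of S \<Longrightarrow> S \<subseteq> I \<Longrightarrow> (\<Sum>k\<in>d. Sup k - Inf k) < \<delta> \<Longrightarrow>
        (\<Sum>k\<in>d. norm (y (Sup k) - y (Inf k))) < \<epsilon> / M"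
    using y \<epsilon> M unfolding abs_continuous_on_def by (metis divide_pos_pos)
  show "\<exists>\<delta>>0. \<forall>d S. d division_of S \<and> S \<subseteq> I \<and> (\<Sum>k\<in>d. Sup k - Inf k) < \<delta> \<longrightarrow>
        (\<Sum>k\<in>d. norm (w (Sup k) - w (Inf k))) < \<epsilon>"
  proof (intro exI conjI allI impI, rule \<delta>(1), elim conjE)
    fix d S assume d: "d division_of S" "S \<subseteq> I" "(\<Sum>k\<in>d. Sup k - Inf k) < \<delta>"
    have "(\<Sum>k\<in>d. norm (w (Sup k) - w (Inf k))) \<le> (\<Sum>k\<in>d. M * norm (y (Sup k) - y (Inf k)))"
    proof (rule sum_mono)
      fix k assume "k \<in> d"
      then obtain u v where "Inf k = u" "Sup k = v" "u \<in> S" "v \<in> S"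
        using division_interval_real[OF d(1)] by metis
      then have "norm (w (Sup k) - w (Inf k)) \<le> L * norm (y (Sup k) - y (Inf k))"
        using dom d(2) by auto
      also have "\<dots> \<le> M * norm (y (Sup k) - y (Inf k))"
        using M by (simp add: mult_right_mono)
      finally show "norm (w (Sup k) - w (Inf k)) \<le> M * norm (y (Sup k) - y (Inf k))" .
    qed
    also have "\<dots> = M * (\<Sum>k\<in>d. norm (y (Sup k) - y (Inf k)))"
      by (simp add: sum_distrib_left)
    also have "\<dots> < M * (\<epsilon> / M)"
      using \<delta>(2)[OF d] M by (simp add: mult_strict_left_mono del: times_divide_eq_right)
    finally show "(\<Sum>k\<in>d. norm (w (Sup k) - w (Inf k))) < \<epsilon>" using M by simp
  qed
qed

lemma abs_continuous_on_subset:
  "abs_continuous_on I y \<Longrightarrow> J \<subseteq> I \<Longrightarrow> abs_continuous_on J y"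
  unfolding abs_continuous_on_def by (meson order_trans)

lemma abs_continuous_on_Pair:
  fixes y :: "real \<Rightarrow> 'a::real_normed_vector" and w :: "real \<Rightarrow> 'b::real_normed_vector"
  assumes y: "abs_continuous_on I y" and w: "abs_continuous_on I w"
  shows "abs_continuous_on I (\<lambda>t. (y t, w t))"
  unfolding abs_continuous_on_def
proof (intro allI impI)
  fix \<epsilon> :: real assume \<epsilon>: "\<epsilon> > 0"
  obtain \<delta>1 where \<delta>1: "\<delta>1 > 0" "\<And>d S. d division_of S \<Longrightarrow> S \<subseteq> I \<Longrightarrow> (\<Sum>k\<in>d. Sup k - Inf k) < \<delta>1 \<Longrightarrow>
        (\<Sum>k\<in>d. norm (y (Sup k) - y (Inf k))) < \<epsilon> / 2"
    using y \<epsilon> unfolding abs_continuous_on_def by (metis half_gt_zero)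
  obtain \<delta>2 where \<delta>2: "\<delta>2 > 0" "\<And>d S. d division_of S \<Longrightarrow> S \<subseteq> I \<Longrightarrow> (\<Sum>k\<in>d. Sup k - Inf k) < \<delta>2 \<Longrightarrow>
        (\<Sum>k\<in>d. norm (w (Sup k) - w (Inf k))) < \<epsilon> / 2"
    using w \<epsilon> unfolding abs_continuous_on_def by (metis half_gt_zero)
  show "\<exists>\<delta>>0. \<forall>d S. d division_of S \<and> S \<subseteq> I \<and> (\<Sum>k\<in>d. Sup k - Inf k) < \<delta> \<longrightarrow>
        (\<Sum>k\<in>d. norm ((y (Sup k), w (Sup k)) - (y (Inf k), w (Inf k)))) < \<epsilon>"
  proof (intro exI[of _ "min \<delta>1 \<delta>2"] conjI allI impI)
    fix d S assume d: "d division_of S \<and> S \<subseteq> I \<and> (\<Sum>k\<in>d. Sup k - Inf k) < min \<delta>1 \<delta>2"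
    have "(\<Sum>k\<in>d. norm ((y (Sup k), w (Sup k)) - (y (Inf k), w (Inf k)))) \<le>
        (\<Sum>k\<in>d. norm (y (Sup k) - y (Inf k)) + norm (w (Sup k) - w (Inf k)))"
      by (intro sum_mono) (simp add: norm_Pair_le)
    also have "\<dots> < \<epsilon>"
      using \<delta>1(2)[of d S] \<delta>2(2)[of d S] d by (simp add: sum.distrib)
    finally show "(\<Sum>k\<in>d. norm ((y (Sup k), w (Sup k)) - (y (Inf k), w (Inf k)))) < \<epsilon>" .
  qed (use \<delta>1 \<delta>2 in auto)
qed

lemma abs_continuous_on_imp_continuous_on:
  fixes y :: "real \<Rightarrow> 'a::real_normed_vector"
  assumes y: "abs_continuous_on {a..b} y"
  shows "continuous_on {a..b} y"
  unfolding continuous_on_iff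
proof (intro ballI allI impI)
  fix t \<epsilon> :: real assume t: "t \<in> {a..b}" and \<epsilon>: "\<epsilon> > 0"
  obtain \<delta> where \<delta>: "\<delta> > 0" "\<And>d S. d division_of S \<Longrightarrow> S \<subseteq> {a..b} \<Longrightarrow> (\<Sum>k\<in>d. Sup k - Inf k) < \<delta> \<Longrightarrow>
        (\<Sum>k\<in>d. norm (y (Sup k) - y (Inf k))) < \<epsilon>"
    using y \<epsilon> unfolding abs_continuous_on_def by metis
  have *: "norm (y v - y u) < \<epsilon>" if "u \<in> {a..b}" "v \<in> {a..b}" "u \<le> v" "v - u < \<delta>" for u v
  proof -
    have "{{u..v}} division_of {u..v}"
      using division_of_self[of u v] that by auto
    from \<delta>(2)[OF this] that show ?thesis by auto
  qed
  show "\<exists>d>0. \<forall>s\<in>{a..b}. dist s t < d \<longrightarrow> dist (y s) (y t) < \<epsilon>"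
  proof (intro exI[of _ \<delta>] conjI ballI impI \<delta>(1))
    fix s assume "s \<in> {a..b}" "dist s t < \<delta>"
    then show "dist (y s) (y t) < \<epsilon>"
      using *[of s t] *[of t s] t by (cases "s \<le> t") (auto simp: dist_norm norm_minus_commute)
  qed
qed

text \<open>On a compact interval both factors are bounded, so changing one factor at a time
  dominates the increment of the product by that of the pair.\<close>

lemma bounded_bilinear_abs_continuous_on:
  assumes B: "bounded_bilinear B"
    and f: "abs_continuous_on {a..b} f"
    and g: "abs_continuous_on {a..b} g"
  shows "abs_continuous_on {a..b} (\<lambda>t. B (f t) (g t))"
proof -
  interpret bounded_bilinear B by (rule B)
  obtain Cf where Cf: "Cf \<ge> 0" "\<And>t. t \<in> {a..b} \<Longrightarrow> norm (f t) \<le> Cf"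
    using continuous_on_compact_bound[OF compact_Icc abs_continuous_on_imp_continuous_on[OF f]] by blast
  obtain Cg where Cg: "Cg \<ge> 0" "\<And>t. t \<in> {a..b} \<Longrightarrow> norm (g t) \<le> Cg"
    using continuous_on_compact_bound[OF compact_Icc abs_continuous_on_imp_continuous_on[OF g]] by blast
  obtain K where K: "K \<ge> 0" "\<And>x y. norm (B x y) \<le> norm x * norm y * K"
    using nonneg_bounded by auto
  show ?thesis
  proof (rule abs_continuous_on_dominated[OF abs_continuous_on_Pair[OF f g]])
    fix s t assume st: "s \<in> {a..b}" "t \<in> {a..b}"
    let ?p = "norm ((f s, g s) - (f t, g t))"
    have p: "norm (f s - f t) \<le> ?p" "norm (g s - g t) \<le> ?p"
      by (simp_all add: norm_fst_le norm_snd_le)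
    have "B (f s) (g s) - B (f t) (g t) = B (f s - f t) (g s) + B (f t) (g s - g t)"
      by (simp add: diff_left diff_right)
    also have "norm \<dots> \<le> norm (f s - f t) * norm (g s) * K + norm (f t) * norm (g s - g t) * K"
      by (intro norm_triangle_le add_mono K)
    also have "\<dots> \<le> ?p * Cg * K + Cf * ?p * K"
      using Cf Cg K p st by (intro add_mono mult_mono) auto
    finally show "norm (B (f s) (g s) - B (f t) (g t)) \<le> ((Cg + Cf) * K) * ?p"
      by (simp add: algebra_simps)
  qed
qed

lemma abs_continuous_on_compose:
  assumes y: "abs_continuous_on I y" and S: "convex S" "y ` I \<subseteq> S"
    and der: "\<And>x. x \<in> S \<Longrightarrow> (F has_derivative F' x) (at x within S)"
    and bound: "\<And>x. x \<in> S \<Longrightarrow> onorm (F' x) \<le> L"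
  shows "abs_continuous_on I (\<lambda>t. F (y t))"
  by (rule abs_continuous_on_dominated[OF y], rule differentiable_bound[OF S(1) der bound])
    (use S(2) in auto)

lemma abs_continuous_on_compose_real:
  fixes F :: "real \<Rightarrow> real"
  assumes y: "abs_continuous_on I y" and S: "y ` I \<subseteq> {c..d}"
    and der: "\<And>x. x \<in> {c..d} \<Longrightarrow> (F has_real_derivative F' x) (at x)"
    and cont: "continuous_on {c..d} F'"
  shows "abs_continuous_on I (\<lambda>t. F (y t))"
proof -
  obtain L where L: "L \<ge> 0" "\<And>x. x \<in> {c..d} \<Longrightarrow> norm (F' x) \<le> L"
    using continuous_on_compact_bound[OF compact_Icc cont] by blast
  show ?thesis
  proof (rule abs_continuous_on_compose[OF y convex_real_interval(5) S])
    fix x assume x: "x \<in> {c..d}"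
    show "(F has_derivative (*) (F' x)) (at x within {c..d})"
      using der[OF x] by (simp add: has_field_derivative_def has_derivative_at_withinI)
    show "onorm ((*) (F' x)) \<le> L"
      using L x by (intro onorm_bound) (auto simp: abs_mult intro: mult_right_mono)
  qed
qed

lemma abs_continuous_on_id: "abs_continuous_on I (\<lambda>t. t)"
  unfolding abs_continuous_on_def
proof (intro allI impI)
  fix \<epsilon> :: real assume \<epsilon>: "\<epsilon> > 0"
  show "\<exists>\<delta>>0. \<forall>d S. d division_of S \<and> S \<subseteq> I \<and> (\<Sum>k\<in>d. Sup k - Inf k) < \<delta> \<longrightarrow>
        (\<Sum>k\<in>d. norm (Sup k - Inf k)) < \<epsilon>"
  proof (intro exI[of _ \<epsilon>] conjI allI impI \<epsilon>, elim conjE)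
    fix d S assume d: "d division_of S" "(\<Sum>k\<in>d. Sup k - Inf k) < \<epsilon>"
    have "(\<Sum>k\<in>d. norm (Sup k - Inf k)) = (\<Sum>k\<in>d. Sup k - Inf k)"
    proof (rule sum.cong)
      fix k assume "k \<in> d"
      then obtain u v where "u \<le> v" "Inf k = u" "Sup k = v"
        using division_interval_real[OF d(1)] by metis
      then show "norm (Sup k - Inf k) = Sup k - Inf k" by simp
    qed simp
    then show "(\<Sum>k\<in>d. norm (Sup k - Inf k)) < \<epsilon>" using d by simp
  qed
qed

section \<open>Fundamental theorem of calculus and Gronwall inequality for absolutely continuous
  functions\<close>

lemma negligible_if_AE_lborel:
  assumes "AE t in lborel. P t"
  shows "negligible {t::'a::euclidean_space. \<not> P t}"
proof -
  obtain N where "{t. \<not> P t} \<subseteq> N" "N \<in> null_sets lborel"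
    using assms by (auto simp: eventually_ae_filter)
  then show ?thesis
    by (meson negligible_iff_null_sets null_sets_completionI negligible_subset)
qed

text \<open>At the tags in \<open>N\<close> the gauge confines the intervals to an open set of small measure, where
  absolute continuity controls the total increment; elsewhere differentiability does.\<close>

lemma abs_continuous_on_has_integral:
  fixes y :: "real \<Rightarrow> 'a::banach"
  assumes ab: "a \<le> b" and y: "abs_continuous_on {a..b} y" and N: "negligible N"
    and der: "\<And>t. t \<in> {a..b} - N \<Longrightarrow> (y has_vector_derivative y' t) (at t within {a..b})"
  shows "(y' has_integral (y b - y a)) {a..b}"
proof (cases "a = b")
  case True
  then show ?thesis using has_integral_refl(2)[of y' b] by simp
next
  case False
  with ab have ab': "a < b" by simp
  \<comment> \<open>Nothing is known about \<open>y'\<close> on \<open>N\<close>. With the value 0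
    there, a tag in \<open>N\<close> leaves only the increment of \<open>y\<close> in the Riemann
    sum; the change is undone by a spike argument at the end.\<close>
  define g where "g t = (if t \<in> N then 0 else y' t)" for t
  have "(g has_integral (y b - y a)) {a..b}"
    unfolding has_integral_factor_content_real
  proof (intro allI impI)
    fix e :: real assume e: "e > 0"
    \<comment> \<open>Half of the admissible error e * (b - a) is granted to the tags in
      \<open>N\<close>, the other half, as e/2 per unit of length, to all other tags.\<close>
    define \<epsilon> where "\<epsilon> = e * (b - a) / 2"
    have \<epsilon>: "\<epsilon> > 0" using e ab' by (simp add: \<epsilon>_def)
    obtain \<delta> where \<delta>: "\<delta> > 0" "\<And>d S. d division_of S \<Longrightarrow> S \<subseteq> {a..b} \<Longrightarrow>
        (\<Sum>k\<in>d. Sup k - Inf k) < \<delta> \<Longrightarrow> (\<Sum>k\<in>d. norm (y (Sup k) - y (Inf k))) < \<epsilon>"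
      using y \<epsilon> unfolding abs_continuous_on_def by metis
    have "N \<in> sets lebesgue" and N0: "emeasure lebesgue N = 0"
      using N by (auto simp: negligible_iff_null_sets null_sets_def)
    obtain U where U: "open U" "N \<subseteq> U" "emeasure lebesgue (U - N) < ennreal \<delta>"
      by (rule sets_lebesgue_outer_open[OF \<open>N \<in> sets lebesgue\<close> \<delta>(1)])
    then have U3: "U \<in> sets lebesgue" by auto
    have "emeasure lebesgue U < ennreal \<delta>"
    proof -
      have "emeasure lebesgue U \<le> emeasure lebesgue (U - N) + emeasure lebesgue N"
        using U U3 \<open>N \<in> sets lebesgue\<close>
        by (metis Un_Diff_cancel2 Un_absorb1 Un_commute emeasure_subadditive sets.Diff)
      then show ?thesis using N0 U(3) by simp
    qed
    then have "emeasure lebesgue U < \<infinity>" using ennreal_less_top less_trans by fastforce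
    then have "U \<in> lmeasurable" using U3 by (simp add: fmeasurableI)
    moreover from this have "measure lebesgue U < \<delta>"
      using \<open>emeasure lebesgue U < ennreal \<delta>\<close> by (simp add: emeasure_eq_measure2 ennreal_less_iff)
    ultimately have Umeas: "U \<in> lmeasurable" "measure lebesgue U < \<delta>" by auto
    have "\<exists>G. open G \<and> t \<in> G \<and> (t \<in> N \<longrightarrow> G \<subseteq> U) \<and>
        (t \<in> {a..b} - N \<longrightarrow> (\<forall>s\<in>G \<inter> {a..b}. norm (y s - y t - (s - t) *\<^sub>R y' t) \<le> e/2 * \<bar>s - t\<bar>))" for t
    proof (cases "t \<in> N")
      case True
      with U show ?thesis by (intro exI[of _ U]) auto
    next
      case tN: False
      show ?thesis
      proof (cases "t \<in> {a..b}")
        case True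
        have "(y has_derivative (\<lambda>x. x *\<^sub>R y' t)) (at t within {a..b})"
          using der[of t] True tN by (simp add: has_vector_derivative_def)
        then obtain r where "r > 0" "\<And>s. s \<in> {a..b} \<Longrightarrow> norm (s - t) < r \<Longrightarrow>
            norm (y s - y t - (s - t) *\<^sub>R y' t) \<le> e/2 * norm (s - t)"
          unfolding has_derivative_within_alt using e by (metis half_gt_zero)
        then show ?thesis using tN
          by (intro exI[of _ "ball t r"]) (auto simp: dist_norm norm_minus_commute)
      next
        case False
        with tN show ?thesis by auto
      qed
    qed
    then obtain G where G: "\<And>t. open (G t)" "\<And>t. t \<in> G t" "\<And>t. t \<in> N \<Longrightarrow> G t \<subseteq> U"
        "\<And>t s. t \<in> {a..b} - N \<Longrightarrow> s \<in> G t \<inter> {a..b} \<Longrightarrow> norm (y s - y t - (s - t) *\<^sub>R y' t) \<le> e/2 * \<bar>s - t\<bar>"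
      by metis
    have gauge: "gauge G" using G by (simp add: gauge_def)
    have main: "norm ((\<Sum>(x, k)\<in>p. measure lborel k *\<^sub>R g x) - (y b - y a)) \<le> e * measure lborel {a..b}"
      if p: "p tagged_division_of {a..b}" and fine: "G fine p" for p
    proof -
      have fin: "finite p" using p by auto
      define q where "q = {xk\<in>p. fst xk \<in> N}"
      define D where "D = snd ` q"
      have qp: "q \<subseteq> p" by (auto simp: q_def)
      have q: "q tagged_division_of (\<Union>D)"
        unfolding D_def by (meson p qp tagged_division_of_def tagged_partial_division_of_Union_self tagged_partial_division_subset)
      have D: "D division_of (\<Union>D)" unfolding D_def by (rule division_of_tagged_division[OF q[unfolded D_def]])
      have interval: "\<exists>u v. k = {u..v} \<and> u \<le> v \<and> x \<in> {u..v} \<and> {u..v} \<subseteq> {a..b} \<and> {u..v} \<subseteq> G x" if xk: "(x, k) \<in> p" for x k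
      proof -
        obtain u v where "k = cbox u v" using tagged_division_ofD(4)[OF p xk] by auto
        moreover have "x \<in> k" "k \<subseteq> {a..b}" using tagged_division_ofD(2,3)[OF p xk] by auto
        moreover have "k \<subseteq> G x" using fine xk by (auto simp: fine_def)
        ultimately show ?thesis by auto
      qed
      have over: "(\<Sum>(x,k)\<in>q. F k) = (\<Sum>k\<in>D. F k)" if F: "\<And>u. F {u..u} = 0" for F :: "real set \<Rightarrow> real"
      proof -
        \<comment> \<open>Reindexing asks for the value 0 on every box with empty interior, the
          empty set included, where \<open>Sup\<close> and \<open>Inf\<close> mean nothing. No
          interval of a division is empty, so the sums do not change.\<close>
        define F' where "F' k = (if k = {} then 0 else F k)" for k
        have "(\<Sum>(x,k)\<in>q. F k) = (\<Sum>(x,k)\<in>q. F' k)"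
          using interval by (intro sum.cong) (fastforce simp: F'_def q_def)+
        also have "\<dots> = (\<Sum>k\<in>snd ` q. F' k)"
        proof (rule sum.over_tagged_division_lemma[OF q])
          fix u v :: real assume "box u v = {}"
          then have "cbox u v = {} \<or> u = v" by auto
          then show "F' (cbox u v) = 0" using F by (auto simp: F'_def)
        qed
        also have "\<dots> = (\<Sum>k\<in>D. F k)"
          using division_ofD(3)[OF D] by (intro sum.cong) (auto simp: F'_def D_def)
        finally show ?thesis .
      qed
      have DU: "\<Union>D \<subseteq> U"
      proof -
        { fix x k assume "(x,k) \<in> p" "x \<in> N"
          then have "k \<subseteq> U" using interval[of x k] G(3)[of x] by auto }
        then show ?thesis by (force simp: D_def q_def)
      qed
      have Dab: "\<Union>D \<subseteq> {a..b}" using interval by (fastforce simp: D_def q_def)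
      have "(\<Sum>k\<in>D. Sup k - Inf k) = (\<Sum>k\<in>D. measure lebesgue k)"
      proof (rule sum.cong)
        fix k assume "k \<in> D"
        then obtain u v where "u \<le> v" "k = {u..v}" "Inf k = u" "Sup k = v"
          using division_interval_real[OF D] by metis
        then show "Sup k - Inf k = measure lebesgue k" by simp
      qed simp
      also have "\<dots> = measure lebesgue (\<Union>D)"
        using content_division[OF D] by simp
      also have "\<dots> \<le> measure lebesgue U"
        using DU Umeas(1) D by (intro measure_mono_fmeasurable) (auto intro: lmeasurable_division fmeasurableD)
      finally have "(\<Sum>k\<in>D. norm (y (Sup k) - y (Inf k))) < \<epsilon>"
        using \<delta>(2)[OF D Dab] Umeas(2) by linarith
      then have qsum: "(\<Sum>(x,k)\<in>q. norm (y (Sup k) - y (Inf k))) < \<epsilon>"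
        by (subst over) auto
      have "(\<Sum>(x, k)\<in>p. measure lborel k *\<^sub>R g x) - (y b - y a)
          = (\<Sum>(x, k)\<in>p. measure lborel k *\<^sub>R g x - (y (Sup k) - y (Inf k)))"
        using additive_tagged_division_1[OF ab p, of y] by (simp add: case_prod_unfold sum_subtractf)
      also have "norm \<dots> \<le> (\<Sum>(x, k)\<in>p. norm (measure lborel k *\<^sub>R g x - (y (Sup k) - y (Inf k))))"
        by (rule order_trans[OF norm_sum]) (simp add: case_prod_unfold)
      also have "\<dots> \<le> (\<Sum>(x, k)\<in>p. e/2 * measure lborel k + (if x \<in> N then norm (y (Sup k) - y (Inf k)) else 0))"
      proof (rule sum_mono, clarify)
        fix x k assume xk: "(x, k) \<in> p"
        then obtain u v where uv: "k = {u..v}" "u \<le> v" "x \<in> {u..v}" "{u..v} \<subseteq> {a..b}" "{u..v} \<subseteq> G x"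
          using interval by blast
        show "norm (measure lborel k *\<^sub>R g x - (y (Sup k) - y (Inf k)))
            \<le> e/2 * measure lborel k + (if x \<in> N then norm (y (Sup k) - y (Inf k)) else 0)"
        proof (cases "x \<in> N")
          case True
          then show ?thesis using e by (simp add: g_def norm_minus_commute)
        next
          case False
          have x: "x \<in> {a..b} - N" using False uv by auto
          have mem: "u \<in> G x \<inter> {a..b}" "v \<in> G x \<inter> {a..b}" using uv by auto
          \<comment> \<open>Straddling: both end points are compared with the tag between them, so
            the two errors add up to e/2 times the length.\<close>
          have "measure lborel k *\<^sub>R g x - (y (Sup k) - y (Inf k))
              = (y u - y x - (u - x) *\<^sub>R y' x) - (y v - y x - (v - x) *\<^sub>R y' x)"
            using uv False by (simp add: g_def algebra_simps)
          also have "norm \<dots> \<le> e/2 * \<bar>u - x\<bar> + e/2 * \<bar>v - x\<bar>"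
            by (intro order_trans[OF norm_triangle_ineq4] add_mono G(4)[OF x] mem)
          also have "\<dots> = e/2 * measure lborel k"
            using uv by (simp add: field_simps)
          finally show ?thesis using False by simp
        qed
      qed
      also have "\<dots> = e/2 * (\<Sum>(x, k)\<in>p. measure lborel k) + (\<Sum>(x,k)\<in>q. norm (y (Sup k) - y (Inf k)))"
        using fin by (simp add: case_prod_unfold sum.distrib sum_distrib_left q_def sum.inter_filter)
      also have "\<dots> \<le> e/2 * (b - a) + \<epsilon>"
        using qsum additive_content_tagged_division[of p a b] p ab by simp
      also have "\<dots> = e * measure lborel {a..b}" using ab by (simp add: \<epsilon>_def field_simps)
      finally show ?thesis .
    qed
    show "\<exists>d. gauge d \<and> (\<forall>p. p tagged_division_of {a..b} \<and> d fine p \<longrightarrow>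
        norm ((\<Sum>(x, k)\<in>p. measure lborel k *\<^sub>R g x) - (y b - y a)) \<le> e * measure lborel {a..b})"
      using gauge main by (intro exI[of _ G]) simp
  qed
  moreover have "y' t = g t" if "t \<in> {a..b} - N" for t
    using that by (simp add: g_def)
  ultimately show ?thesis
    using has_integral_spike[OF N, of "{a..b}" y' g] by blast
qed

text \<open>With the integrating factor exp (q t) the product has a nonpositive derivative almost
  everywhere, and absolute continuity turns this into a nonpositive increment.\<close>

lemma abs_continuous_gronwall:
  fixes V :: "real \<Rightarrow> real"
  assumes ab: "a \<le> b" and V: "abs_continuous_on {a..b} V"
    and AE: "AE t in lborel. a < t \<longrightarrow> t < b \<longrightarrow> (\<exists>v. (V has_vector_derivative v) (at t) \<and> v \<le> - q * V t)"
  shows "V b \<le> V a * exp (- q * (b - a))"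
proof -
  define W where "W t = V t * exp (q * t)" for t
  have "abs_continuous_on {a..b} (\<lambda>t. exp (q * t))"
    by (rule abs_continuous_on_compose_real[OF abs_continuous_on_id, where c = a and d = b and F' = "\<lambda>t. q * exp (q * t)"])
      (auto intro!: derivative_eq_intros continuous_intros)
  then have W: "abs_continuous_on {a..b} W"
    unfolding W_def by (rule bounded_bilinear_abs_continuous_on[OF bounded_bilinear_mult V])
  \<comment> \<open>The differential inequality is available in the open interval only, so both end
    points join the exceptional set.\<close>
  define N where "N = {t. \<not> (a < t \<longrightarrow> t < b \<longrightarrow> (\<exists>v. (V has_vector_derivative v) (at t) \<and> v \<le> - q * V t))} \<union> {a, b}"
  have N: "negligible N" unfolding N_def
    using negligible_if_AE_lborel[OF AE] by (intro negligible_Un) auto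
  have "\<forall>t. \<exists>w. t \<in> {a..b} - N \<longrightarrow> (W has_vector_derivative w) (at t) \<and> w \<le> 0"
  proof
    fix t
    show "\<exists>w. t \<in> {a..b} - N \<longrightarrow> (W has_vector_derivative w) (at t) \<and> w \<le> 0"
    proof (cases "t \<in> {a..b} - N")
      case True
      then obtain v where v: "(V has_vector_derivative v) (at t)" "v \<le> - q * V t"
        by (auto simp: N_def)
      have "(W has_real_derivative v * exp (q * t) + V t * (q * exp (q * t))) (at t)"
        unfolding W_def using v(1)[unfolded has_real_derivative_iff_has_vector_derivative[symmetric]]
        by (auto intro!: derivative_eq_intros)
      moreover have "v * exp (q * t) + V t * (q * exp (q * t)) = (v + q * V t) * exp (q * t)"
        by (simp add: algebra_simps)
      moreover have "\<dots> \<le> 0" using v(2) by (intro mult_nonpos_nonneg) auto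
      ultimately show ?thesis by (metis has_real_derivative_iff_has_vector_derivative)
    qed auto
  qed
  then obtain W' where W': "\<And>t. t \<in> {a..b} - N \<Longrightarrow> (W has_vector_derivative W' t) (at t)"
      "\<And>t. t \<in> {a..b} - N \<Longrightarrow> W' t \<le> 0" by metis
  have "((\<lambda>t. if t \<in> N then 0 else W' t) has_integral (W b - W a)) {a..b}"
    by (rule abs_continuous_on_has_integral[OF ab W N])
      (use W'(1) in \<open>auto intro: has_vector_derivative_at_within\<close>)
  moreover have "((\<lambda>t. 0::real) has_integral 0) {a..b}" by simp
  ultimately have "W b - W a \<le> 0"
    by (rule has_integral_le) (use W'(2) in auto)
  then have "V b * exp (q * b) \<le> V a * exp (q * a)" by (simp add: W_def)
  then have "V b * exp (q * b) * exp (- q * b) \<le> V a * exp (q * a) * exp (- q * b)"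
    by (rule mult_right_mono) simp
  then show ?thesis by (simp add: mult.assoc mult_exp_exp algebra_simps)
qed

subsection \<open>Quadratic forms and the history stack\<close>

lemma inner_transpose_mult:
  "x \<bullet> (transpose A *v y) = (A *v x) \<bullet> y" for A :: "real^'a^'b"
  by (metis dot_lmul_matrix inner_commute transpose_matrix_vector)

lemma bounded_bilinear_matrix_vector_mult:
  "bounded_bilinear (\<lambda>A v. (A :: real^'a^'b) *v v)"
proof -
  have "bilinear (\<lambda>A v. (A :: real^'a^'b) *v v)"
    unfolding bilinear_def
    by (auto intro!: linearI simp: matrix_vector_mult_add_rdistrib matrix_vector_right_distrib
        scaleR_matrix_vector_assoc matrix_vector_mult_scaleR)
  then show ?thesis by (simp add: bilinear_conv_bounded_bilinear)
qed

lemma mat_vector_mult: "mat c *v v = c *\<^sub>R v" for v :: "real^'a"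
  by (simp add: vec_eq_iff matrix_vector_mult_def mat_def if_distrib if_distribR sum.delta'
      cong del: if_weak_cong)

text \<open>A nonnegative form is minimal at a vector where it vanishes; if \<open>A *v u\<close>
  were not 0, moving from \<open>u\<close> against it would make the form negative.\<close>

lemma semidefinite_null_vector:
  fixes A :: "real^'a^'a"
  assumes sym: "\<And>u v. u \<bullet> (A *v v) = v \<bullet> (A *v u)"
    and psd: "\<And>v. 0 \<le> v \<bullet> (A *v v)" and u: "u \<bullet> (A *v u) = 0"
  shows "A *v u = 0"
proof (rule ccontr)
  define w where "w = A *v u"
  define s where "s = w \<bullet> (A *v w)"
  \<comment> \<open>A step close to the minimiser - (w . w) / s; the added 1 avoids division by 0
    and still leaves s - 2 (s + 1) negative.\<close>
  define t where "t = - (w \<bullet> w) / (s + 1)"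
  assume "A *v u \<noteq> 0"
  then have w: "w \<bullet> w > 0" by (simp add: w_def)
  have s: "s \<ge> 0" using psd by (simp add: s_def)
  have "(u + t *\<^sub>R w) \<bullet> (A *v (u + t *\<^sub>R w)) = 2 * t * (w \<bullet> w) + t\<^sup>2 * s"
    using u sym[of u w]
    by (simp add: matrix_vector_right_distrib matrix_vector_mult_scaleR inner_add_left inner_add_right
        s_def power2_eq_square algebra_simps flip: w_def)
  also have "\<dots> = (w \<bullet> w)\<^sup>2 * (s - 2 * (s + 1)) / (s + 1)\<^sup>2"
  proof -
    have "2 * (- a / r) * a + (- a / r)\<^sup>2 * s = a\<^sup>2 * (s - 2 * r) / r\<^sup>2" if "r \<noteq> 0" for a r :: real
      using that by (simp add: field_simps power2_eq_square)
    then show ?thesis using s by (simp add: t_def)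
  qed
  also have "\<dots> < 0"
    using w s by (intro divide_neg_pos mult_pos_neg) auto
  finally show False using psd[of "u + t *\<^sub>R w"] by simp
qed

lemma lambda_min_le_quadratic_form:
  fixes A :: "real^'a^'a"
  assumes sym: "\<And>u v. u \<bullet> (A *v v) = v \<bullet> (A *v u)"
  shows "lambda_min A * (norm v)\<^sup>2 \<le> v \<bullet> (A *v v)"
proof -
  define E where "E = {c. \<exists>v. v \<noteq> 0 \<and> A *v v = c *\<^sub>R v}"
  \<comment> \<open>\<open>Min\<close> is meaningful for finite sets only. Eigenvectors of distinct
    eigenvalues are orthogonal, so there are finitely many eigenvalues.\<close>
  have "finite E"
  proof -
    have "\<forall>c\<in>E. \<exists>v. v \<noteq> 0 \<and> A *v v = c *\<^sub>R v" by (simp add: E_def)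
    from bchoice[OF this] obtain f where "\<forall>c\<in>E. f c \<noteq> 0 \<and> A *v f c = c *\<^sub>R f c" ..
    then have f: "c \<in> E \<Longrightarrow> f c \<noteq> 0" "c \<in> E \<Longrightarrow> A *v f c = c *\<^sub>R f c" for c by auto
    have orth: "f c \<bullet> f d = 0" if "c \<in> E" "d \<in> E" "c \<noteq> d" for c d
      using sym[of "f c" "f d"] f(2) that by (auto simp: inner_commute)
    have "inj_on f E"
      by (rule inj_onI) (metis f(1) inner_eq_zero_iff orth)
    moreover have "finite (f ` E)"
      by (rule pairwise_orthogonal_imp_finite) (auto simp: pairwise_def orthogonal_def intro: orth)
    ultimately show ?thesis by (simp add: finite_image_iff)
  qed
  have "continuous_on (sphere 0 1) (\<lambda>v. v \<bullet> (A *v v))"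
    by (intro continuous_intros linear_continuous_on matrix_vector_mul_bounded_linear)
  moreover have "sphere (0::real^'a) 1 \<noteq> {}" by (metis (no_types) norm_axis_1 mem_sphere_0 empty_iff)
  ultimately obtain u where u: "norm u = 1" and min: "\<And>v. norm v = 1 \<Longrightarrow> u \<bullet> (A *v u) \<le> v \<bullet> (A *v v)"
    using continuous_attains_inf[of "sphere (0::real^'a) 1" "\<lambda>v. v \<bullet> (A *v v)"] by auto
  define c where "c = u \<bullet> (A *v u)"
  have c: "c * (norm v)\<^sup>2 \<le> v \<bullet> (A *v v)" for v
  proof (cases "v = 0")
    case False
    have "c \<le> (v /\<^sub>R norm v) \<bullet> (A *v (v /\<^sub>R norm v))"
      unfolding c_def using False by (intro min) simp
    also have "\<dots> = v \<bullet> (A *v v) / (norm v)\<^sup>2"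
      by (simp add: matrix_vector_mult_scaleR power2_eq_square divide_inverse)
    finally show ?thesis using False by (simp add: field_simps)
  qed simp
  \<comment> \<open>The minimum \<open>c\<close> of the form on the unit sphere is an eigenvalue:
    \<open>A - mat c\<close> is semidefinite and its form vanishes at the minimiser.\<close>
  have "(A - mat c) *v u = 0"
  proof (rule semidefinite_null_vector)
    have mat: "(A - mat c) *v v = A *v v - c *\<^sub>R v" for v
      by (simp add: matrix_vector_mult_diff_rdistrib mat_vector_mult)
    show "x \<bullet> ((A - mat c) *v y) = y \<bullet> ((A - mat c) *v x)" for x y
      unfolding mat using sym[of x y] by (simp add: inner_diff_right inner_commute)
    show "0 \<le> v \<bullet> ((A - mat c) *v v)" for v
      unfolding mat using c[of v] by (simp add: inner_diff_right dot_square_norm)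
    show "u \<bullet> ((A - mat c) *v u) = 0"
      unfolding mat using u by (simp add: inner_diff_right dot_square_norm c_def)
  qed
  then have "A *v u = c *\<^sub>R u"
    by (simp add: matrix_vector_mult_diff_rdistrib mat_vector_mult)
  then have "c \<in> E" using u by (auto simp: E_def intro!: exI[of _ u])
  then have "lambda_min A \<le> c"
    using \<open>finite E\<close> unfolding lambda_min_def E_def[symmetric] by simp
  then show ?thesis using c[of v] mult_right_mono[of "lambda_min A" c "(norm v)\<^sup>2"] by simp
qed

section \<open>The information matrix of the history stack\<close>

lemma Sigma_Y_mult:
  "Sigma_Y D t *v v = (\<Sum>i\<in>filled D t. let Yi = Y_data D (instant D t i) in
     (1 / (1 + kappa D * (matrix_norm Yi)\<^sup>2)) *\<^sub>R (transpose Yi *v (Yi *v v)))"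
  unfolding Sigma_Y_def Let_def
  by (simp add: bounded_bilinear.sum_left[OF bounded_bilinear_matrix_vector_mult]
      matrix_vector_mul_assoc flip: scaleR_matrix_vector_assoc)

lemma inner_Sigma_Y:
  "u \<bullet> (Sigma_Y D t *v v) = (\<Sum>i\<in>filled D t. let Yi = Y_data D (instant D t i) in
     (1 / (1 + kappa D * (matrix_norm Yi)\<^sup>2)) * ((Yi *v u) \<bullet> (Yi *v v)))"
  unfolding Sigma_Y_mult Let_def by (simp add: inner_sum_right inner_transpose_mult del: transpose_matrix_vector)

lemma Sigma_Y_symmetric: "u \<bullet> (Sigma_Y D t *v v) = v \<bullet> (Sigma_Y D t *v u)"
  unfolding inner_Sigma_Y by (simp add: inner_commute)

lemma Sigma_Y_nonneg: "kappa D > 0 \<Longrightarrow> 0 \<le> v \<bullet> (Sigma_Y D t *v v)"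
  unfolding inner_Sigma_Y Let_def by (intro sum_nonneg mult_nonneg_nonneg) (auto intro!: add_nonneg_nonneg)

text \<open>Fullness freezes the set of occupied slots: either all samples agree and the matrix is
  the same, or some sample was replaced and the growth condition applies. That condition compares
  any two times directly, so no chain of replacements is followed.\<close>

lemma lambda_min_Sigma_Y_mono:
  assumes stack: "history_stack D" and "delta D > 0" and "t1 \<ge> 0" "t1 \<le> t"
    and full: "filled D t1 = {1..slots D}" and nonneg: "lambda_min (Sigma_Y D t1) \<ge> 0"
  shows "lambda_min (Sigma_Y D t1) \<le> lambda_min (Sigma_Y D t)"
proof (cases "t1 = t")
  case False
  with assms have t: "t > t1" by simp
  have "filled D t1 \<subseteq> filled D t"
    and grow: "\<exists>i\<in>filled D t1. instant D t i \<noteq> instant D t1 i \<Longrightarrow>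
      lambda_min (Sigma_Y D t) > (1 + delta D) * lambda_min (Sigma_Y D t1)"
    using stack t \<open>t1 \<ge> 0\<close> unfolding history_stack_def by blast+
  then have filled: "filled D t = filled D t1" using full by (auto simp: filled_def)
  show ?thesis
  proof (cases "\<exists>i\<in>filled D t1. instant D t i \<noteq> instant D t1 i")
    case True
    have "lambda_min (Sigma_Y D t1) \<le> (1 + delta D) * lambda_min (Sigma_Y D t1)"
      using nonneg \<open>delta D > 0\<close> by (simp add: algebra_simps)
    then show ?thesis using grow[OF True] by simp
  next
    case False
    then have "Sigma_Y D t = Sigma_Y D t1"
      unfolding Sigma_Y_def filled by (intro sum.cong) auto
    then show ?thesis by simp
  qed
qed simp

section \<open>Solving with a coercive matrix, in place of its inverse\<close>

lemma coercive_norm_le: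
  fixes G :: "real^'a^'a"
  assumes "lo * (norm v)\<^sup>2 \<le> v \<bullet> (G *v v)"
  shows "lo * norm v \<le> norm (G *v v)"
proof (cases "v = 0")
  case False
  have "lo * norm v * norm v \<le> norm (G *v v) * norm v"
    using assms norm_cauchy_schwarz[of v "G *v v"] by (simp add: power2_eq_square mult.commute mult.left_commute)
  then show ?thesis using False by simp
qed simp

lemma coercive_surj:
  fixes G :: "real^'a^'a"
  assumes "lo > 0" "\<And>v. lo * (norm v)\<^sup>2 \<le> v \<bullet> (G *v v)"
  shows "\<exists>w. G *v w = u"
proof -
  have "v = 0" if "G *v v = 0" for v
    using coercive_norm_le[OF assms(2), of v] that assms(1) by (simp add: mult_le_0_iff)
  then have "inj ((*v) G)"
    by (simp add: linear_injective_0[OF matrix_vector_mul_linear])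
  then have "surj ((*v) G)"
    by (rule linear_inj_imp_surj[OF matrix_vector_mul_linear])
  then show ?thesis by (metis surjD)
qed

text \<open>Subtracting the equations at \<open>s\<close> and \<open>t\<close> expresses
  \<open>G s *v (w s - w t)\<close> through increments of \<theta> and \<open>G\<close>. Coercivity
  divides by \<open>G s\<close>, and \<open>w t\<close> is bounded because \<theta> is.\<close>

lemma abs_continuous_on_coercive_solve:
  fixes G :: "real \<Rightarrow> real^'a^'a"
  assumes lo: "lo > 0" and coercive: "\<And>t v. t \<in> {a..b} \<Longrightarrow> lo * (norm v)\<^sup>2 \<le> v \<bullet> (G t *v v)"
    and G: "abs_continuous_on {a..b} G" and \<theta>: "abs_continuous_on {a..b} \<theta>"
    and w: "\<And>t. t \<in> {a..b} \<Longrightarrow> G t *v w t = \<theta> t"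
  shows "abs_continuous_on {a..b} w"
proof -
  obtain C where C: "\<And>t. t \<in> {a..b} \<Longrightarrow> norm (\<theta> t) \<le> C"
    using continuous_on_compact_bound[OF compact_Icc abs_continuous_on_imp_continuous_on[OF \<theta>]] by blast
  obtain K where K: "K \<ge> 0" "\<And>(A::real^'a^'a) v. norm (A *v v) \<le> norm A * norm v * K"
    using bounded_bilinear.nonneg_bounded[OF bounded_bilinear_matrix_vector_mult] by metis
  show ?thesis
  proof (rule abs_continuous_on_dominated[OF abs_continuous_on_Pair[OF \<theta> G]])
    fix s t assume st: "s \<in> {a..b}" "t \<in> {a..b}"
    let ?p = "norm ((\<theta> s, G s) - (\<theta> t, G t))"
    have p: "norm (\<theta> s - \<theta> t) \<le> ?p" "norm (G s - G t) \<le> ?p"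
      by (simp_all add: norm_fst_le norm_snd_le)
    have wt: "norm (w t) \<le> C / lo"
      using coercive_norm_le[OF coercive[OF st(2), of "w t"]] w[OF st(2)] C[OF st(2)] lo
      by (simp add: field_simps)
    have "lo * norm (w s - w t) \<le> norm (G s *v (w s - w t))"
      by (rule coercive_norm_le[OF coercive[OF st(1)]])
    also have "G s *v (w s - w t) = (\<theta> s - \<theta> t) - (G s - G t) *v w t"
      using w st by (simp add: matrix_vector_mult_diff_rdistrib matrix_vector_mult_diff_distrib)
    also have "norm \<dots> \<le> norm (\<theta> s - \<theta> t) + norm (G s - G t) * norm (w t) * K"
      by (intro order_trans[OF norm_triangle_ineq4] add_mono K order_refl)
    also have "\<dots> \<le> ?p + ?p * (C / lo) * K"
      using p wt K order_trans[OF norm_ge_zero wt]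
      by (intro add_mono mult_mono mult_nonneg_nonneg) auto
    finally show "norm (w s - w t) \<le> ((1 + C / lo * K) / lo) * ?p"
      using lo by (simp add: field_simps)
  qed
qed

text \<open>Differentiability of \<open>w\<close> is a conclusion here. The candidate
  \<open>d\<close> comes from formally differentiating the equation; \<open>G s\<close> maps the
  error of the difference quotient to a quantity tending to 0, and coercivity brings this back to
  the error.\<close>

lemma has_vector_derivative_coercive_solve:
  fixes G :: "real \<Rightarrow> real^'a^'a"
  assumes lo: "lo > 0" and coercive: "\<forall>\<^sub>F s in at t. \<forall>v. lo * (norm v)\<^sup>2 \<le> v \<bullet> (G s *v v)"
    and w: "\<forall>\<^sub>F s in at t. G s *v w s = \<theta> s" "G t *v w t = \<theta> t"
    and \<theta>: "(\<theta> has_vector_derivative \<theta>') (at t)" and G: "(G has_vector_derivative G') (at t)"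
    and d: "G t *v d = \<theta>' - G' *v w t"
  shows "(w has_vector_derivative d) (at t)"
proof -
  interpret mv: bounded_bilinear "\<lambda>A v. (A :: real^'a^'a) *v v"
    by (rule bounded_bilinear_matrix_vector_mult)
  have quot: "(f has_vector_derivative f') (at t) \<longleftrightarrow> ((\<lambda>s. (f s - f t) /\<^sub>R (s - t)) \<longlongrightarrow> f') (at t)"
    for f :: "real \<Rightarrow> 'z::real_normed_vector" and f'
  proof -
    have "norm ((f s - f t) /\<^sub>R (s - t) - f') = norm (f s - f t - (s - t) *\<^sub>R f') / norm (s - t)" if "s \<noteq> t" for s
    proof -
      have "(f s - f t) /\<^sub>R (s - t) - f' = (f s - f t - (s - t) *\<^sub>R f') /\<^sub>R (s - t)"
        using that by (simp add: scaleR_right_diff_distrib)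
      then show ?thesis by (simp add: divide_inverse mult.commute)
    qed
    then have "\<forall>\<^sub>F s in at t. norm ((f s - f t) /\<^sub>R (s - t) - f') = norm (f s - f t - (s - t) *\<^sub>R f') / norm (s - t)"
      by (simp add: eventually_at_filter)
    from tendsto_cong[OF this, of 0] show ?thesis
      unfolding has_vector_derivative_def has_derivative_iff_norm
      by (simp add: tendsto_norm_zero_iff LIM_zero_iff bounded_linear_scaleR_left)
  qed
  define e where "e s = (w s - w t) /\<^sub>R (s - t) - d" for s
  have Gt: "(G \<longlongrightarrow> G t) (at t)"
    using has_vector_derivative_continuous[OF G] by (simp add: continuous_within)
  have "((\<lambda>s. (\<theta> s - \<theta> t) /\<^sub>R (s - t) - ((G s - G t) /\<^sub>R (s - t)) *v w t - G s *v d) \<longlongrightarrow>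
      \<theta>' - G' *v w t - G t *v d) (at t)"
    using \<theta> G Gt unfolding quot by (intro tendsto_diff mv.tendsto tendsto_const)
  then have lim: "((\<lambda>s. (\<theta> s - \<theta> t) /\<^sub>R (s - t) - ((G s - G t) /\<^sub>R (s - t)) *v w t - G s *v d) \<longlongrightarrow> 0) (at t)"
    using d by simp
  have "(e \<longlongrightarrow> 0) (at t)"
  proof (rule Lim_null_comparison)
    show "((\<lambda>s. norm ((\<theta> s - \<theta> t) /\<^sub>R (s - t) - ((G s - G t) /\<^sub>R (s - t)) *v w t - G s *v d) / lo) \<longlongrightarrow> 0) (at t)"
      using tendsto_divide[OF tendsto_norm[OF lim] tendsto_const, of lo] lo by simp
    show "\<forall>\<^sub>F s in at t. norm (e s) \<le>
        norm ((\<theta> s - \<theta> t) /\<^sub>R (s - t) - ((G s - G t) /\<^sub>R (s - t)) *v w t - G s *v d) / lo"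
      using coercive w(1)
    proof eventually_elim
      case (elim s)
      have "(\<theta> s - \<theta> t) /\<^sub>R (s - t) - ((G s - G t) /\<^sub>R (s - t)) *v w t - G s *v d = G s *v e s"
        unfolding e_def elim(2)[symmetric] w(2)[symmetric]
        by (simp add: mv.diff_left mv.diff_right mv.scaleR_left mv.scaleR_right scaleR_right_diff_distrib)
      then show ?case
        using coercive_norm_le[of lo "e s" "G s"] elim(1) lo by (simp add: field_simps)
    qed
  qed
  then show ?thesis
    unfolding quot e_def by (simp add: LIM_zero_iff)
qed

text \<open>This bounds e . G^-1 e from below by |e|^2 / hi, with e = \<open>G *v w\<close>. Testing
  semidefiniteness at w - e / hi avoids matrix square roots.\<close>

lemma norm_sq_le_quadratic_form:
  fixes G :: "real^'a^'a"
  assumes hi: "hi > 0" and sym: "\<And>u v. u \<bullet> (G *v v) = v \<bullet> (G *v u)"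
    and psd: "\<And>v. 0 \<le> v \<bullet> (G *v v)" and le: "\<And>v. v \<bullet> (G *v v) \<le> hi * (norm v)\<^sup>2"
  shows "(norm (G *v w))\<^sup>2 / hi \<le> w \<bullet> (G *v w)"
proof -
  define u where "u = G *v w"
  have "0 \<le> (w - u /\<^sub>R hi) \<bullet> (G *v (w - u /\<^sub>R hi))" by (rule psd)
  also have "\<dots> = w \<bullet> u - 2 * (norm u)\<^sup>2 / hi + u \<bullet> (G *v u) / hi\<^sup>2"
    using sym[of w u]
    by (simp add: matrix_vector_mult_diff_distrib matrix_vector_mult_scaleR inner_diff_left
        inner_diff_right dot_square_norm power2_eq_square divide_inverse algebra_simps flip: u_def)
  also have "u \<bullet> (G *v u) / hi\<^sup>2 \<le> (norm u)\<^sup>2 / hi"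
    using le[of u] hi by (simp add: field_simps power2_eq_square)
  finally show ?thesis by (simp add: u_def)
qed

lemma mult_columnvector_rowvector:
  fixes G :: "real^'p^'p"
  shows "(G ** (columnvector \<mu> :: real^1^'p) ** rowvector \<mu>) *v v = (\<mu> \<bullet> v) *\<^sub>R (G *v \<mu>)"
proof -
  have "(columnvector \<mu> :: real^1^'p) *v (rowvector \<mu> *v v) = (\<mu> \<bullet> v) *\<^sub>R \<mu>"
    by (simp add: vec_eq_iff matrix_vector_mult_def columnvector_def rowvector_def inner_vec_def)
  then show ?thesis
    by (simp add: matrix_vector_mult_scaleR flip: matrix_vector_mul_assoc)
qed

text \<open>On the boundary of \<open>\<Theta>\<close> the correction term has the sign of \<open>(\<theta> - \<mu>) \<bullet> \<mu> \<le> 0\<close>, so the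
  projection never hurts in the direction \<open>G\<^sup>-\<^sup>1 (\<theta> - \<mu>)\<close>.\<close>

lemma inner_proj_ge:
  fixes D :: "('n::finite, 'm::finite, 'p::finite) adaptive_system"
  assumes lo: "lo > 0" and coercive: "\<And>v. lo * (norm v)\<^sup>2 \<le> v \<bullet> (G *v v)"
    and sym: "\<And>u v. u \<bullet> (G *v v) = v \<bullet> (G *v u)"
    and \<theta>: "norm \<theta> \<le> theta_bar D" and w: "G *v w = \<theta> - \<mu>"
  shows "w \<bullet> proj G (Theta D) \<mu> v \<ge> w \<bullet> v"
proof (cases "\<mu> \<in> frontier (Theta D) \<and> \<mu> \<bullet> v > 0")
  case True
  have "Theta D = cball 0 (theta_bar D)" by (auto simp: Theta_def)
  then have "frontier (Theta D) \<subseteq> sphere 0 (theta_bar D)"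
    by (auto simp: frontier_def)
  then have \<mu>: "norm \<mu> = theta_bar D" using True by auto
  have "\<mu> \<noteq> 0" using True by auto
  then have pos: "\<mu> \<bullet> (G *v \<mu>) > 0"
    using coercive[of \<mu>] lo by (smt (verit) mult_pos_pos zero_less_norm_iff zero_less_power)
  have "\<theta> \<bullet> \<mu> \<le> norm \<theta> * norm \<mu>" by (rule norm_cauchy_schwarz)
  also have "\<dots> \<le> norm \<mu> * norm \<mu>" using \<theta> \<mu> norm_ge_zero[of \<mu>] by (intro mult_right_mono) auto
  finally have "w \<bullet> (G *v \<mu>) \<le> 0"
    using sym[of w \<mu>] w by (simp add: inner_diff_right inner_commute dot_square_norm power2_eq_square)
  then have "(\<mu> \<bullet> v) * (w \<bullet> (G *v \<mu>)) / (\<mu> \<bullet> (G *v \<mu>)) \<le> 0"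
    using pos True by (intro divide_nonpos_pos mult_nonneg_nonpos) auto
  moreover have "w \<bullet> proj G (Theta D) \<mu> v = w \<bullet> v - (\<mu> \<bullet> v) * (w \<bullet> (G *v \<mu>)) / (\<mu> \<bullet> (G *v \<mu>))"
    using True by (simp add: proj_def matrix_vector_mult_diff_rdistrib inner_diff_right
        mult_columnvector_rowvector flip: scaleR_matrix_vector_assoc)
  ultimately show ?thesis by simp
qed (auto simp: proj_def)

lemma loewner_bounds:
  fixes G :: "real^'p^'p"
  assumes "transpose G = G" "loewner_le (mat lo) G" "loewner_le G (mat hi)"
  shows "lo * (norm v)\<^sup>2 \<le> v \<bullet> (G *v v)" "v \<bullet> (G *v v) \<le> hi * (norm v)\<^sup>2"
    "u \<bullet> (G *v v) = v \<bullet> (G *v u)"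
proof -
  have "0 \<le> v \<bullet> ((G - mat lo) *v v)" "0 \<le> v \<bullet> ((mat hi - G) *v v)"
    using assms by (auto simp: loewner_le_def pos_semidef_def)
  then show "lo * (norm v)\<^sup>2 \<le> v \<bullet> (G *v v)" "v \<bullet> (G *v v) \<le> hi * (norm v)\<^sup>2"
    by (simp_all add: matrix_vector_mult_diff_rdistrib inner_diff_right mat_vector_mult dot_square_norm)
  show "u \<bullet> (G *v v) = v \<bullet> (G *v u)"
    using inner_transpose_mult[of u G v] assms(1) by (simp add: inner_commute)
qed

subsection \<open>Lyapunov analysis\<close>

text \<open>Derivative of \<open>V = z\<^sup>2 + (\<theta> - \<mu>) \<bullet> w\<close>, \<open>w = G\<^sup>-\<^sup>1 (\<theta> - \<mu>)\<close>, along the error system: the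
  barrier coupling cancels, and the gain dynamics give back at most half of the learning term.\<close>

lemma lyapunov_derivative_le:
  fixes D :: "('n::finite, 'm::finite, 'p::finite) adaptive_system"
  assumes lo: "lo > 0" and coercive: "\<And>v. lo * (norm v)\<^sup>2 \<le> v \<bullet> (G *v v)"
    and sym: "\<And>u v. u \<bullet> (G *v v) = v \<bullet> (G *v u)"
    and \<theta>: "norm (theta D) \<le> theta_bar D" and w: "G *v w = e"
    and gains: "k_theta D > 0" "beta_theta D > 0" "kappa D > 0"
    and F: "error_rhs D G t (z, e) = (z', e')"
  shows "2 * z * z' + 2 * (w \<bullet> e') - w \<bullet> (Gamma_rhs D zt th t G *v w)
    \<le> - 2 * gamma D * z\<^sup>2 - k_theta D * (e \<bullet> (Sigma_Y D t *v e))"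
proof -
  define S where "S = Sigma_Y D t"
  define g where "g = transpose (pY D (xsig D t)) *v gradient (hfun D) (xsig D t)"
  define v where "v = k_theta D *\<^sub>R (G *v (S *v e)) + (Phi_z D t * z) *\<^sub>R (G *v g)"
  have "gradient (hfun D) (xsig D t) \<bullet> (pY D (xsig D t) *v e) = e \<bullet> g"
    unfolding g_def inner_transpose_mult by (simp add: inner_commute)
  with F have z': "z' = Phi_z D t * (e \<bullet> g) - gamma D * z"
    and e': "e' = - proj G (Theta D) (theta D - e) v"
    by (auto simp: error_rhs_def v_def S_def g_def)
  have wG: "w \<bullet> (G *v u) = e \<bullet> u" for u
    using sym[of w u] w by (simp add: inner_commute)
  have "w \<bullet> v = k_theta D * (e \<bullet> (S *v e)) + Phi_z D t * z * (e \<bullet> g)"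
    by (simp add: v_def inner_add_right wG)
  moreover have "w \<bullet> v \<le> w \<bullet> proj G (Theta D) (theta D - e) v"
    using w by (intro inner_proj_ge[OF lo coercive sym \<theta>]) simp
  ultimately have we': "w \<bullet> e' \<le> - k_theta D * (e \<bullet> (S *v e)) - Phi_z D t * z * (e \<bullet> g)"
    by (simp add: e')
  have S: "0 \<le> e \<bullet> (S *v e)" unfolding S_def by (rule Sigma_Y_nonneg[OF gains(3)])
  \<comment> \<open>With the update on, the right-hand side is beta_theta (w . G w) - k_theta (e . S
    e), otherwise 0. Both values satisfy the bound, so \<open>zt\<close> and \<open>th\<close> can
    stay arbitrary.\<close>
  have "- (k_theta D * (e \<bullet> (S *v e))) \<le> w \<bullet> (Gamma_rhs D zt th t G *v w)"
  proof -
    have "0 \<le> w \<bullet> (G *v w)" using coercive[of w] lo by (smt (verit) mult_nonneg_nonneg zero_le_power2)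
    moreover have "(G ** S ** G) *v w = G *v (S *v e)"
      by (simp add: w flip: matrix_vector_mul_assoc)
    ultimately show ?thesis
      using S gains unfolding Gamma_rhs_def S_def[symmetric]
      by (auto simp: matrix_vector_mult_diff_rdistrib inner_diff_right wG simp flip: scaleR_matrix_vector_assoc)
  qed
  with we' show ?thesis
    unfolding z' S_def[symmetric] by (simp add: algebra_simps power2_eq_square)
qed

text \<open>The rate is left free because the lemma serves twice: with 0, where it gives
  monotonicity from the initial time on, and with a positive rate once the stack is full.\<close>

lemma lyapunov_decay:
  fixes D :: "('n::finite, 'm::finite, 'p::finite) adaptive_system"
  defines "V \<equiv> \<lambda>y w t. (fst (y t))\<^sup>2 + snd (y t) \<bullet> w t"
  assumes sol: "caratheodory_solution t0 (\<lambda>t. error_rhs D (G t) t) y"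
    and Gain: "Gamma_gain D t0 zt th G"
    and lo: "Gamma_lo D > 0" and \<theta>: "norm (theta D) \<le> theta_bar D"
    and gains: "k_theta D > 0" "beta_theta D > 0" "kappa D > 0"
    and w: "\<And>t. t \<ge> t0 \<Longrightarrow> G t *v w t = snd (y t)"
    and ab: "t0 \<le> a" "a \<le> b"
    and rate: "\<And>t. a < t \<Longrightarrow> q * V y w t \<le>
      2 * gamma D * (fst (y t))\<^sup>2 + k_theta D * (snd (y t) \<bullet> (Sigma_Y D t *v snd (y t)))"
  shows "V y w b \<le> V y w a * exp (- q * (b - a))"
proof (rule abs_continuous_gronwall[OF ab(2)])
  note G = loewner_bounds[of "G t" "Gamma_lo D" "Gamma_hi D" for t]
  have GB: "Gamma_lo D * (norm v)\<^sup>2 \<le> v \<bullet> (G t *v v)" "u \<bullet> (G t *v v) = v \<bullet> (G t *v u)" if "t \<ge> t0" for t u v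
    using G(1,3)[of t] Gain that unfolding Gamma_gain_def by auto
  have acy: "abs_continuous_on {a..b} y"
    by (rule abs_continuous_on_subset[of "{t0..b}"]) (use sol ab in \<open>auto simp: caratheodory_solution_def\<close>)
  have acG: "abs_continuous_on {a..b} G"
    by (rule abs_continuous_on_subset[of "{t0..b}"])
      (use Gain ab in \<open>auto simp: caratheodory_solution_def Gamma_gain_def\<close>)
  have ac1: "abs_continuous_on {a..b} (\<lambda>t. fst (y t))"
    by (rule abs_continuous_on_dominated[OF acy, where L = 1])
      (metis fst_diff mult_1 norm_fst_le prod.collapse)
  have ac2: "abs_continuous_on {a..b} (\<lambda>t. snd (y t))"
    by (rule abs_continuous_on_dominated[OF acy, where L = 1])
      (metis snd_diff mult_1 norm_snd_le prod.collapse)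
  have acw: "abs_continuous_on {a..b} w"
    by (rule abs_continuous_on_coercive_solve[OF lo _ acG ac2]) (use GB w ab in auto)
  have "abs_continuous_on {a..b} (\<lambda>t. (fst (y t) * fst (y t), snd (y t) \<bullet> w t))"
    by (intro abs_continuous_on_Pair bounded_bilinear_abs_continuous_on[OF bounded_bilinear_mult ac1 ac1]
        bounded_bilinear_abs_continuous_on[OF bounded_bilinear_inner ac2 acw])
  then show "abs_continuous_on {a..b} (V y w)"
  proof (rule abs_continuous_on_dominated[where L = 2])
    fix s t
    let ?p = "\<lambda>t. (fst (y t) * fst (y t), snd (y t) \<bullet> w t)"
    have "V y w s - V y w t = fst (?p s - ?p t) + snd (?p s - ?p t)"
      by (simp add: V_def power2_eq_square)
    then show "norm (V y w s - V y w t) \<le> 2 * norm (?p s - ?p t)"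
      using norm_triangle_ineq[of "fst (?p s - ?p t)" "snd (?p s - ?p t)"]
        norm_fst_le[of "fst (?p s - ?p t)" "snd (?p s - ?p t)"] norm_snd_le[of "snd (?p s - ?p t)" "fst (?p s - ?p t)"]
      by simp
  qed
  have "AE t in lborel. t0 < t \<longrightarrow> (y has_vector_derivative error_rhs D (G t) t (y t)) (at t)"
    using sol by (simp add: caratheodory_solution_def)
  moreover have "AE t in lborel. t0 < t \<longrightarrow> (G has_vector_derivative Gamma_rhs D zt th t (G t)) (at t)"
    using Gain by (simp add: caratheodory_solution_def Gamma_gain_def)
  ultimately show "AE t in lborel. a < t \<longrightarrow> t < b \<longrightarrow>
      (\<exists>v. (V y w has_vector_derivative v) (at t) \<and> v \<le> - q * V y w t)"
  proof eventually_elim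
    case (elim t)
    show ?case
    proof (intro impI)
      assume at: "a < t" and "t < b"
      obtain z e where y: "y t = (z, e)" by fastforce
      obtain z' e' where F: "error_rhs D (G t) t (z, e) = (z', e')" by fastforce
      have t: "t > t0" using at ab by simp
      have yder: "(y has_vector_derivative (z', e')) (at t)"
        and Gder: "(G has_vector_derivative Gamma_rhs D zt th t (G t)) (at t)"
        using elim t y F by auto
      have zder: "((\<lambda>t. fst (y t)) has_vector_derivative z') (at t)"
        using bounded_linear.has_vector_derivative[OF bounded_linear_fst yder] by simp
      have eder: "((\<lambda>t. snd (y t)) has_vector_derivative e') (at t)"
        using bounded_linear.has_vector_derivative[OF bounded_linear_snd yder] by simp
      \<comment> \<open>Coercivity and the equation for \<open>w\<close> are known from
        \<open>t0\<close> on only, while the derivative is two-sided.\<close>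
      have nbh: "\<forall>\<^sub>F s in at t. s > t0"
        using t eventually_at_filter order_tendstoD(1)[OF tendsto_ident_at, of t0 t UNIV] by simp
      obtain d where d: "G t *v d = e' - Gamma_rhs D zt th t (G t) *v w t"
        using coercive_surj[OF lo, of "G t"] GB(1)[of t] t by (metis less_imp_le)
      have wder: "(w has_vector_derivative d) (at t)"
      proof (rule has_vector_derivative_coercive_solve[where G = G and w = w and t = t, OF lo _ _ _ eder Gder d])
        show "\<forall>\<^sub>F s in at t. \<forall>v. Gamma_lo D * (norm v)\<^sup>2 \<le> v \<bullet> (G s *v v)"
          using nbh by eventually_elim (use GB(1) in auto)
        show "\<forall>\<^sub>F s in at t. G s *v w s = snd (y s)"
          using nbh by eventually_elim (use w in auto)
        show "G t *v w t = snd (y t)" using w t by simp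
      qed
      have "((\<lambda>t. fst (y t) * fst (y t) + snd (y t) \<bullet> w t) has_vector_derivative
          (fst (y t) * z' + z' * fst (y t)) + (snd (y t) \<bullet> d + e' \<bullet> w t)) (at t)"
        by (intro has_vector_derivative_add bounded_bilinear.has_vector_derivative[OF bounded_bilinear_mult zder zder]
            bounded_bilinear.has_vector_derivative[OF bounded_bilinear_inner eder wder])
      \<comment> \<open>Replacing e by \<open>G t *v w t\<close> and moving the symmetric
        \<open>G t\<close> onto \<open>d\<close> makes the defining equation of \<open>d\<close>
        applicable.\<close>
      moreover have "e \<bullet> d = w t \<bullet> e' - w t \<bullet> (Gamma_rhs D zt th t (G t) *v w t)"
        using GB(2)[of t d "w t"] w[of t] t y by (simp add: d inner_diff_right inner_commute)
      then have "(fst (y t) * z' + z' * fst (y t)) + (snd (y t) \<bullet> d + e' \<bullet> w t) =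
          2 * z * z' + 2 * (w t \<bullet> e') - w t \<bullet> (Gamma_rhs D zt th t (G t) *v w t)"
        by (simp add: y algebra_simps inner_commute)
      moreover have "V y w = (\<lambda>t. fst (y t) * fst (y t) + snd (y t) \<bullet> w t)"
        by (simp add: V_def power2_eq_square)
      ultimately have "(V y w has_vector_derivative
          2 * z * z' + 2 * (w t \<bullet> e') - w t \<bullet> (Gamma_rhs D zt th t (G t) *v w t)) (at t)"
        by simp
      moreover have "2 * z * z' + 2 * (w t \<bullet> e') - w t \<bullet> (Gamma_rhs D zt th t (G t) *v w t) \<le> - q * V y w t"
        using lyapunov_derivative_le[OF lo GB(1)[of t] GB(2)[of t] \<theta> _ gains F, of "w t" zt th]
          rate[of t] at t w[of t] y by simp
      ultimately show "\<exists>v. (V y w has_vector_derivative v) (at t) \<and> v \<le> - q * V y w t" by blast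
    qed
  qed
qed

text \<open>Before the stack is full, \<open>V\<close> is only non-increasing; the factor \<open>exp (r * t1)\<close> makes up
  for this initial phase.\<close>

lemma error_system_exponentially_stable:
  fixes D :: "('n::finite, 'm::finite, 'p::finite) adaptive_system"
  assumes kappa: "kappa D > 0" and delta: "delta D > 0" and stack: "history_stack D"
    and gains: "k_theta D > 0" "beta_theta D > 0" "gamma D > 0"
    and lo: "0 < Gamma_lo D" and hi: "Gamma_lo D \<le> Gamma_hi D"
    and \<theta>: "norm (theta D) \<le> theta_bar D"
    and \<sigma>: "\<sigma> > 0" and t1: "t1 \<ge> 0" and full: "filled D t1 = {1..slots D}"
    and lmin: "lambda_min (Sigma_Y D t1) = \<sigma>"
  shows "exponentially_stable (error_rhs D)
    (\<lambda>t0 G e. Gamma_gain D t0 (\<lambda>t. fst (e t)) (\<lambda>t. theta D - snd (e t)) G)"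
proof -
  define lo where "lo = Gamma_lo D"
  define hi where "hi = Gamma_hi D"
  have lohi: "lo > 0" "hi > 0" using assms by (auto simp: lo_def hi_def)
  \<comment> \<open>The first entry is the rate of the barrier part. The second is that of the
    parameter part: e . w <= |e|^2 / lo, so k \<sigma> |e|^2 is at least k \<sigma> lo (e .
    w).\<close>
  define q where "q = min (2 * gamma D) (k_theta D * \<sigma> * lo)"
  have q: "q > 0" using gains \<sigma> lohi by (simp add: q_def)
  \<comment> \<open>\<open>m\<close> and \<open>M\<close> compare V with the squared norm of the
    state; the entry 1 accounts for the barrier part.\<close>
  define m where "m = min 1 (1 / hi)"
  define M where "M = max 1 (1 / lo)"
  have mM: "m > 0" "M > 0" using lohi by (auto simp: m_def M_def)
  define K where "K = sqrt (M / m * exp (q * t1))"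
  have K: "K > 0" using mM by (simp add: K_def)
  have decay: "norm (y t) \<le> K * norm (y t0) * exp (- (q / 2) * (t - t0))"
    if t0: "t0 \<ge> 0" and sol: "caratheodory_solution t0 (\<lambda>t. error_rhs D (G t) t) y"
      and Gain: "Gamma_gain D t0 (\<lambda>t. fst (y t)) (\<lambda>t. theta D - snd (y t)) G" and t: "t \<ge> t0"
    for t0 G t and y :: "real \<Rightarrow> real \<times> (real^'p)"
  proof -
    have GB: "lo * (norm v)\<^sup>2 \<le> v \<bullet> (G s *v v)" "v \<bullet> (G s *v v) \<le> hi * (norm v)\<^sup>2"
        "u \<bullet> (G s *v v) = v \<bullet> (G s *v u)" if "s \<ge> t0" for s u v
      using loewner_bounds[of "G s" lo hi] Gain that unfolding Gamma_gain_def lo_def hi_def by auto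
    have "\<exists>w. G s *v w = snd (y s)" if "s \<ge> t0" for s
      using coercive_surj[OF lohi(1), of "G s"] GB(1)[OF that] by blast
    then obtain w where w: "\<And>s. s \<ge> t0 \<Longrightarrow> G s *v w s = snd (y s)" by metis
    define V where "V s = (fst (y s))\<^sup>2 + snd (y s) \<bullet> w s" for s
    have ysq: "(norm (y s))\<^sup>2 = (fst (y s))\<^sup>2 + (norm (snd (y s)))\<^sup>2" for s
      by (simp add: norm_prod_def)
    have upper: "snd (y s) \<bullet> w s \<le> (norm (snd (y s)))\<^sup>2 / lo" if "s \<ge> t0" for s
    proof -
      have "lo * norm (w s) \<le> norm (snd (y s))"
        using coercive_norm_le[OF GB(1)[OF that]] w[OF that] by metis
      then have "norm (w s) \<le> norm (snd (y s)) / lo" using lohi by (simp add: field_simps)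
      then have "norm (snd (y s)) * norm (w s) \<le> norm (snd (y s)) * (norm (snd (y s)) / lo)"
        by (rule mult_left_mono) simp
      then show ?thesis using norm_cauchy_schwarz[of "snd (y s)" "w s"] by (simp add: power2_eq_square)
    qed
    have lower: "(norm (snd (y s)))\<^sup>2 / hi \<le> snd (y s) \<bullet> w s" if "s \<ge> t0" for s
    proof -
      have "0 \<le> v \<bullet> (G s *v v)" for v
        using GB(1)[OF that, of v] lohi(1) by (smt (verit) mult_nonneg_nonneg zero_le_power2)
      then show ?thesis
        using norm_sq_le_quadratic_form[OF lohi(2) GB(3)[OF that] _ GB(2)[OF that], of "w s"] w[OF that]
        by (simp add: inner_commute)
    qed
    have Vup: "V s \<le> M * (norm (y s))\<^sup>2" if "s \<ge> t0" for s
    proof -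
      have "1 * (fst (y s))\<^sup>2 \<le> M * (fst (y s))\<^sup>2" "1 / lo * (norm (snd (y s)))\<^sup>2 \<le> M * (norm (snd (y s)))\<^sup>2"
        by (intro mult_right_mono; simp add: M_def)+
      then show ?thesis using upper[OF that] by (simp add: V_def ysq algebra_simps)
    qed
    have Vlow: "m * (norm (y s))\<^sup>2 \<le> V s" if "s \<ge> t0" for s
    proof -
      have "m * (fst (y s))\<^sup>2 \<le> 1 * (fst (y s))\<^sup>2" "m * (norm (snd (y s)))\<^sup>2 \<le> 1 / hi * (norm (snd (y s)))\<^sup>2"
        by (intro mult_right_mono; simp add: m_def)+
      then show ?thesis using lower[OF that] by (simp add: V_def ysq algebra_simps)
    qed
    have Vnonneg: "0 \<le> V s" if "s \<ge> t0" for s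
      using Vlow[OF that] mM by (smt (verit) mult_nonneg_nonneg zero_le_power2)
    have dec: "V b \<le> V a * exp (- p * (b - a))"
      if ab: "t0 \<le> a" "a \<le> b" and "\<And>s. a < s \<Longrightarrow> p * V s \<le>
        2 * gamma D * (fst (y s))\<^sup>2 + k_theta D * (snd (y s) \<bullet> (Sigma_Y D s *v snd (y s)))" for a b p
      unfolding V_def
      by (rule lyapunov_decay[OF sol Gain assms(7) \<theta> gains(1,2) kappa w ab])
        (use that(3) in \<open>simp_all add: V_def\<close>)
    have dec0: "V b \<le> V a" if "t0 \<le> a" "a \<le> b" for a b
      using dec[of a b 0] that gains Sigma_Y_nonneg[OF kappa] by simp
    have decq: "V b \<le> V a * exp (- q * (b - a))" if "t0 \<le> a" "t1 \<le> a" "a \<le> b" for a b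
    proof (rule dec[OF that(1,3)])
      fix s assume s: "a < s"
      let ?e = "snd (y s)"
      have "\<sigma> * (norm ?e)\<^sup>2 \<le> lambda_min (Sigma_Y D s) * (norm ?e)\<^sup>2"
        using lambda_min_Sigma_Y_mono[OF stack delta t1 _ full, of s] lmin \<sigma> s that
        by (intro mult_right_mono) auto
      also have "\<dots> \<le> ?e \<bullet> (Sigma_Y D s *v ?e)"
        by (rule lambda_min_le_quadratic_form[OF Sigma_Y_symmetric])
      finally have "k_theta D * (\<sigma> * (norm ?e)\<^sup>2) \<le> k_theta D * (?e \<bullet> (Sigma_Y D s *v ?e))"
        using gains by simp
      moreover have "q * (?e \<bullet> w s) \<le> k_theta D * (\<sigma> * (norm ?e)\<^sup>2)"
      proof -
        have "q * (?e \<bullet> w s) \<le> q * ((norm ?e)\<^sup>2 / lo)"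
          using upper[of s] q s that by (intro mult_left_mono) auto
        also have "\<dots> \<le> (k_theta D * \<sigma> * lo) * ((norm ?e)\<^sup>2 / lo)"
          using lohi by (intro mult_right_mono) (auto simp: q_def)
        finally show ?thesis using lohi by simp
      qed
      moreover have "q * (fst (y s))\<^sup>2 \<le> 2 * gamma D * (fst (y s))\<^sup>2"
        by (intro mult_right_mono) (auto simp: q_def)
      ultimately show "q * V s \<le> 2 * gamma D * (fst (y s))\<^sup>2 + k_theta D * (?e \<bullet> (Sigma_Y D s *v ?e))"
        by (simp add: V_def distrib_left)
    qed
    have "V t \<le> V t0 * (exp (q * t1) * exp (- q * (t - t0)))"
    proof (cases "t1 \<le> t")
      case True
      \<comment> \<open>Both instants are nonnegative, so \<open>a\<close> is at most t0 + t1 and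
        the wait for a full stack delays the decay by at most \<open>t1\<close>.\<close>
      define a where "a = max t0 t1"
      have "V t \<le> V a * exp (- q * (t - a))" using decq[of a t] True t by (simp add: a_def)
      also have "\<dots> \<le> V t0 * exp (- q * (t - a))"
        using dec0[of t0 a] by (intro mult_right_mono) (auto simp: a_def)
      also have "\<dots> \<le> V t0 * exp (q * t1 - q * (t - t0))"
      proof -
        have "q * a \<le> q * (t0 + t1)" using q t0 t1 by (intro mult_left_mono) (auto simp: a_def)
        then show ?thesis using Vnonneg[of t0] by (intro mult_left_mono) (auto simp: algebra_simps)
      qed
      finally show ?thesis by (simp add: mult_exp_exp)
    next
      case False
      have "V t \<le> V t0" using dec0 t by simp
      also have "\<dots> \<le> V t0 * exp (q * t1 - q * (t - t0))"
      proof -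
        have "q * (t - t0) \<le> q * t1" using q t0 False by (intro mult_left_mono) auto
        then show ?thesis using Vnonneg[of t0] by (simp add: mult_le_cancel_left1)
      qed
      finally show ?thesis by (simp add: mult_exp_exp)
    qed
    also have "\<dots> \<le> M * (norm (y t0))\<^sup>2 * (exp (q * t1) * exp (- q * (t - t0)))"
      using Vup[of t0] by (intro mult_right_mono) auto
    finally have "m * (norm (y t))\<^sup>2 \<le> M * (norm (y t0))\<^sup>2 * (exp (q * t1) * exp (- q * (t - t0)))"
      using Vlow[OF t] by simp
    then have "(norm (y t))\<^sup>2 \<le> M / m * exp (q * t1) * (norm (y t0))\<^sup>2 * exp (- q * (t - t0))"
      using mM by (simp add: field_simps)
    also have "\<dots> = (K * norm (y t0) * exp (- (q / 2) * (t - t0)))\<^sup>2"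
      using mM by (simp add: K_def power_mult_distrib real_sqrt_pow2 flip: exp_double)
    finally show ?thesis
      by (rule power2_le_imp_le) (use K in auto)
  qed
  have "error_rhs D G t 0 = 0" for G t
    by (simp add: error_rhs_def proj_def zero_prod_def)
  moreover have "q / 2 > 0" using q by simp
  \<comment> \<open>V is quadratic, so the norm decays at half its rate. \<open>decay\<close> covers
    every initial state, and the radius is set to 1.\<close>
  ultimately show ?thesis
    unfolding exponentially_stable_def using decay K
    by (intro conjI exI[of _ "1::real"] exI[of _ K] exI[of _ "q / 2"]) auto
qed

subsection \<open>The error dynamics\<close>

text \<open>\<open>gradient\<close> is a definite description, so both existence and uniqueness have
  to be shown; the representing vector collects the values of the derivative on the basis.\<close>

lemma GDERIV_gradient:
  fixes h :: "real^'n \<Rightarrow> real"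
  assumes "h differentiable (at x)"
  shows "GDERIV h x :> gradient h x"
proof -
  obtain h' where h': "(h has_derivative h') (at x)" using assms by (auto simp: differentiable_def)
  then interpret bounded_linear h' by (rule has_derivative_bounded_linear)
  define g where "g = (\<Sum>b\<in>Basis. h' b *\<^sub>R b)"
  have "h' = (\<lambda>v. v \<bullet> g)"
  proof
    fix v
    have "h' v = h' (\<Sum>b\<in>Basis. (v \<bullet> b) *\<^sub>R b)"
      by (simp add: euclidean_representation)
    also have "\<dots> = v \<bullet> g" by (simp add: sum scaleR g_def inner_sum_right mult.commute)
    finally show "h' v = v \<bullet> g" .
  qed
  then have g: "GDERIV h x :> g" using h' by (simp add: gderiv_def)
  have "g' = g" if "GDERIV h x :> g'" for g'
  proof -
    have "(\<lambda>v. v \<bullet> g') = (\<lambda>v. v \<bullet> g)"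
      using that g unfolding gderiv_def by (rule has_derivative_unique)
    then have "\<forall>v. v \<bullet> g' = v \<bullet> g" by (rule fun_cong[THEN allI])
    then show ?thesis by (simp only: vector_eq_ldot)
  qed
  then show ?thesis
    using g unfolding gradient_def
    by (intro theI[where P = "\<lambda>D. GDERIV h x :> D" and a = g])
qed

lemma smooth_on_imp_DERIV:
  assumes "smooth_on S F" "x \<in> S"
  shows "(F has_real_derivative deriv F x) (at x)"
proof -
  have "(deriv ^^ 0) F field_differentiable at x" using assms unfolding smooth_on_def by blast
  then show ?thesis by (simp add: field_differentiable_derivI)
qed

lemma smooth_on_imp_continuous_deriv:
  assumes "smooth_on S F"
  shows "continuous_on S (deriv F)"
proof (rule continuous_at_imp_continuous_on, rule ballI)
  fix x assume "x \<in> S"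
  then have "(deriv ^^ 1) F field_differentiable at x" using assms unfolding smooth_on_def by blast
  then show "isCont (deriv F) x" by (simp add: field_differentiable_imp_continuous_at)
qed

text \<open>\<open>inv_into\<close> returns some preimage; strict decrease of \<open>B\<close> makes
  it the only one. This is what turns \<open>Phi_z\<close> into the factor B'(h(x)) of the chain
  rule.\<close>

lemma barrier_Phi_eq:
  assumes B: "barrier_function B" and a: "a > 0"
  shows "barrier_Phi B (B a) = deriv B a"
proof -
  have "\<exists>y. (B has_real_derivative y) (at x) \<and> y < 0" if "x > 0" for x
    using B that smooth_on_imp_DERIV[of "{0<..}" B x] unfolding barrier_function_def
    by (intro exI[of _ "deriv B x"]) simp
  then have "B d < B c" if "0 < c" "c < d" for c d
    by (rule DERIV_neg_imp_decreasing[OF that(2)]) (use that in linarith)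
  then have "inj_on B {0<..}"
    by (intro inj_onI) (metis greaterThan_iff less_irrefl linorder_neqE)
  then show ?thesis using a by (simp add: barrier_Phi_def)
qed

section \<open>The barrier state along the trajectory\<close>

lemma plant_trajectory_hfun_pos:
  "plant_trajectory D \<Longrightarrow> t \<ge> 0 \<Longrightarrow> hfun D (xsig D t) > 0"
  by (simp add: plant_trajectory_def safe_interior_def)

text \<open>Over a compact time interval the state stays in a ball, which is convex and where the
  gradient of h is bounded, and h stays in a compact part of the positive axis, where B' is
  bounded.\<close>

lemma abs_continuous_on_zsig:
  assumes h: "C1_function (hfun D)" and B: "barrier_function (barB D)"
    and traj: "plant_trajectory D" and b: "b \<ge> 0"
  shows "abs_continuous_on {0..b} (zsig D)"
proof -
  have x: "abs_continuous_on {0..b} (xsig D)"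
    using traj b by (simp add: plant_trajectory_def caratheodory_solution_def)
  obtain R where R: "\<And>t. t \<in> {0..b} \<Longrightarrow> norm (xsig D t) \<le> R"
    using continuous_on_compact_bound[OF compact_Icc abs_continuous_on_imp_continuous_on[OF x]] by blast
  have "continuous_on (cball 0 R) (gradient (hfun D))"
    using h continuous_on_subset by (auto simp: C1_function_def)
  then obtain L where L: "L \<ge> 0" "\<And>x. x \<in> cball 0 R \<Longrightarrow> norm (gradient (hfun D) x) \<le> L"
    using continuous_on_compact_bound[OF compact_cball] by blast
  have hx: "abs_continuous_on {0..b} (\<lambda>t. hfun D (xsig D t))"
  proof (rule abs_continuous_on_compose[OF x convex_cball])
    show "xsig D ` {0..b} \<subseteq> cball 0 R" using R by auto
    fix x :: "real^'a" assume x: "x \<in> cball 0 R"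
    show "(hfun D has_derivative (\<lambda>v. v \<bullet> gradient (hfun D) x)) (at x within cball 0 R)"
      using GDERIV_gradient[of "hfun D" x] h
      by (simp add: C1_function_def gderiv_def has_derivative_at_withinI)
    show "onorm (\<lambda>v. v \<bullet> gradient (hfun D) x) \<le> L"
    proof (rule onorm_bound[OF L(1)])
      fix v
      show "norm (v \<bullet> gradient (hfun D) x) \<le> L * norm v"
        using Cauchy_Schwarz_ineq2[of v "gradient (hfun D) x"] mult_left_mono[OF L(2)[OF x] norm_ge_zero[of v]]
        by (simp add: mult.commute)
    qed
  qed
  have cont: "continuous_on {0..b} (\<lambda>t. hfun D (xsig D t))"
    by (rule abs_continuous_on_imp_continuous_on[OF hx])
  obtain s where s: "s \<in> {0..b}" "\<And>t. t \<in> {0..b} \<Longrightarrow> hfun D (xsig D s) \<le> hfun D (xsig D t)"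
    using continuous_attains_inf[OF compact_Icc _ cont] b by (metis atLeastAtMost_iff empty_iff order_refl)
  obtain s' where s': "\<And>t. t \<in> {0..b} \<Longrightarrow> hfun D (xsig D t) \<le> hfun D (xsig D s')"
    using continuous_attains_sup[OF compact_Icc _ cont] b by (metis atLeastAtMost_iff empty_iff order_refl)
  \<comment> \<open>The smallest value of h is attained, hence positive: it keeps the trajectory
    away from the singularity of B at 0.\<close>
  define c where "c = hfun D (xsig D s)"
  define d where "d = hfun D (xsig D s')"
  have c: "c > 0" unfolding c_def using s plant_trajectory_hfun_pos[OF traj] by simp
  have smooth: "smooth_on {0<..} (barB D)" using B by (simp add: barrier_function_def)
  have "abs_continuous_on {0..b} (\<lambda>t. barB D (hfun D (xsig D t)))"
  proof (rule abs_continuous_on_compose_real[OF hx])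
    show "(\<lambda>t. hfun D (xsig D t)) ` {0..b} \<subseteq> {c..d}" using s s' by (auto simp: c_def d_def)
    show "(barB D has_real_derivative deriv (barB D) a) (at a)" if "a \<in> {c..d}" for a
      using smooth_on_imp_DERIV[OF smooth] that c by simp
    show "continuous_on {c..d} (deriv (barB D))"
      using smooth_on_imp_continuous_deriv[OF smooth] by (rule continuous_on_subset) (use c in auto)
  qed
  then show ?thesis
    by (rule abs_continuous_on_dominated[where L = 1]) (simp add: zsig_def)
qed

lemma zsig_has_vector_derivative:
  assumes h: "C1_function (hfun D)" and B: "barrier_function (barB D)"
    and traj: "plant_trajectory D" and t: "t \<ge> 0"
    and x: "(xsig D has_vector_derivative x') (at t)"
  shows "(zsig D has_vector_derivative Phi_z D t * (gradient (hfun D) (xsig D t) \<bullet> x')) (at t)"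
proof -
  have pos: "hfun D (xsig D t) > 0" by (rule plant_trajectory_hfun_pos[OF traj t])
  have "(barB D has_real_derivative Phi_z D t) (at (hfun D (xsig D t)))"
    using smooth_on_imp_DERIV[of "{0<..}" "barB D" "hfun D (xsig D t)"] B pos
    by (simp add: Phi_z_def zsig_def barrier_Phi_eq[OF B pos]) (simp add: barrier_function_def)
  moreover have "((hfun D \<circ> xsig D) has_vector_derivative x' \<bullet> gradient (hfun D) (xsig D t)) (at t)"
    using vector_derivative_diff_chain_within[OF x, of "hfun D" "\<lambda>v. v \<bullet> gradient (hfun D) (xsig D t)"]
      GDERIV_gradient[of "hfun D" "xsig D t"] h
    by (simp add: gderiv_def C1_function_def has_derivative_at_withinI)
  ultimately have "((barB D \<circ> (hfun D \<circ> xsig D)) has_vector_derivative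
      (x' \<bullet> gradient (hfun D) (xsig D t)) * Phi_z D t) (at t)"
    by (intro field_vector_diff_chain_at) simp_all
  then have "((\<lambda>t. (barB D \<circ> (hfun D \<circ> xsig D)) t - beta0 D) has_vector_derivative
      (x' \<bullet> gradient (hfun D) (xsig D t)) * Phi_z D t - 0) (at t)"
    by (intro has_vector_derivative_diff has_vector_derivative_const)
  then show ?thesis
    by (simp add: zsig_def[abs_def] inner_commute mult.commute)
qed

text \<open>The plant equation is integrated over the delay window, which the bound on
  \<open>r\<close> keeps in nonnegative time.\<close>

lemma X_data_eq:
  assumes traj: "plant_trajectory D" and Y: "locally_lipschitz (pY D)"
    and delay: "delay D > 0" and r: "r \<ge> delay D"
  shows "X_data D r = Y_data D r *v theta D + G_data D r"
proof -
  interpret mv: bounded_bilinear "\<lambda>A v. (A :: real^'c^'a) *v v"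
    by (rule bounded_bilinear_matrix_vector_mult)
  let ?I = "{r - delay D..r}"
  define v where "v t = pf D (xsig D t) + pg D (xsig D t) *v usig D t" for t
  have x: "abs_continuous_on ?I (xsig D)"
    by (rule abs_continuous_on_subset[of "{0..r}"])
      (use traj r delay in \<open>auto simp: plant_trajectory_def caratheodory_solution_def\<close>)
  have "AE t in lborel. t > 0 \<longrightarrow> (xsig D has_vector_derivative pY D (xsig D t) *v theta D + v t) (at t)"
    using traj by (simp add: plant_trajectory_def caratheodory_solution_def v_def add.assoc)
  then have N: "negligible ({t. \<not> (t > 0 \<longrightarrow>
      (xsig D has_vector_derivative pY D (xsig D t) *v theta D + v t) (at t))} \<union> {0})"
    by (intro negligible_Un negligible_if_AE_lborel) auto
  have "((\<lambda>t. pY D (xsig D t) *v theta D + v t) has_integral (xsig D r - xsig D (r - delay D))) ?I"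
    by (rule abs_continuous_on_has_integral[OF _ x N])
      (use delay r in \<open>auto intro: has_vector_derivative_at_within\<close>)
  then have total: "((\<lambda>t. pY D (xsig D t) *v theta D + v t) has_integral X_data D r) ?I"
    by (simp add: X_data_def)
  have "continuous_on UNIV (pY D)"
    using Y local_lipschitz_continuous_on[of UNIV UNIV "\<lambda>_. pY D" 0] by (simp add: locally_lipschitz_def)
  then have "continuous_on ?I (\<lambda>t. pY D (xsig D t))"
    using abs_continuous_on_imp_continuous_on[OF x] by (rule continuous_on_compose2) auto
  then have "((\<lambda>t. pY D (xsig D t)) has_integral Y_data D r) ?I"
    unfolding Y_data_def by (intro integrable_integral integrable_continuous_interval)
  from has_integral_linear[OF this mv.bounded_linear_left[of "theta D"]]
  have Yint: "((\<lambda>t. pY D (xsig D t) *v theta D) has_integral (Y_data D r *v theta D)) ?I"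
    by (simp add: o_def)
  \<comment> \<open>No regularity of the input is assumed; integrability of the known drift follows
    by subtracting the continuous \<open>pY\<close> part from the derivative of the state.\<close>
  from has_integral_diff[OF total this]
  have "(v has_integral (X_data D r - Y_data D r *v theta D)) ?I" by simp
  then show ?thesis by (simp add: G_data_def v_def[symmetric] integral_unique)
qed

text \<open>The recorded data do not contain \<theta>, yet by \<open>X_data_eq\<close> each residual
  is the stored regressor applied to the parameter error. This makes the update law drive that
  error.\<close>

lemma phi_eq:
  assumes traj: "plant_trajectory D" and Y: "locally_lipschitz (pY D)"
    and delay: "delay D > 0" and stack: "history_stack D" and t: "t \<ge> 0"
  shows "phi D t zt th =
    (Phi_z D t * zt) *\<^sub>R (transpose (pY D (xsig D t)) *v gradient (hfun D) (xsig D t)) +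
    k_theta D *\<^sub>R (Sigma_Y D t *v (theta D - th))"
proof -
  have "X_data D (instant D t i) - G_data D (instant D t i) - Y_data D (instant D t i) *v th
      = Y_data D (instant D t i) *v (theta D - th)" if "i \<in> filled D t" for i
    using X_data_eq[OF traj Y delay, of "instant D t i"] stack t that
    by (simp add: history_stack_def matrix_vector_mult_diff_distrib)
  then show ?thesis
    unfolding phi_def Sigma_Y_mult Let_def by simp
qed

lemma error_system_solution:
  assumes h: "C1_function (hfun D)" and B: "barrier_function (barB D)"
    and traj: "plant_trajectory D" and Y: "locally_lipschitz (pY D)"
    and delay: "delay D > 0" and stack: "history_stack D" and t0: "t0 \<ge> 0"
    and zh: "caratheodory_solution t0 (zhat_rhs D th) zh"
    and th: "caratheodory_solution t0 (thetahat_rhs D (\<lambda>t. zsig D t - zh t) G) th"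
  shows "caratheodory_solution t0 (\<lambda>t. error_rhs D (G t) t) (\<lambda>t. (zsig D t - zh t, theta D - th t))"
  unfolding caratheodory_solution_def
proof (intro conjI allI impI)
  fix b assume b: "b \<ge> t0"
  have z: "abs_continuous_on {t0..b} (zsig D)"
    by (rule abs_continuous_on_subset[OF abs_continuous_on_zsig[OF h B traj, of b]]) (use b t0 in auto)
  have zh_ac: "abs_continuous_on {t0..b} zh" and th_ac: "abs_continuous_on {t0..b} th"
    using zh th b by (auto simp: caratheodory_solution_def)
  have "abs_continuous_on {t0..b} (\<lambda>t. (zsig D t, zh t))"
    by (rule abs_continuous_on_Pair[OF z zh_ac])
  then have "abs_continuous_on {t0..b} (\<lambda>t. zsig D t - zh t)"
  proof (rule abs_continuous_on_dominated[where L = 2])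
    fix s t
    let ?p = "(zsig D s, zh s) - (zsig D t, zh t)"
    have "\<bar>zsig D s - zsig D t\<bar> \<le> norm ?p" "\<bar>zh s - zh t\<bar> \<le> norm ?p"
      using norm_fst_le[of "zsig D s - zsig D t" "zh s - zh t"] norm_snd_le[of "zh s - zh t" "zsig D s - zsig D t"]
      by simp_all
    then show "norm (zsig D s - zh s - (zsig D t - zh t)) \<le> 2 * norm ?p" by (simp add: abs_if split: if_splits)
  qed
  moreover have "abs_continuous_on {t0..b} (\<lambda>t. theta D - th t)"
    by (rule abs_continuous_on_dominated[OF th_ac, where L = 1]) (simp add: norm_minus_commute)
  ultimately show "abs_continuous_on {t0..b} (\<lambda>t. (zsig D t - zh t, theta D - th t))"
    by (rule abs_continuous_on_Pair)
next
  have "AE t in lborel. t > 0 \<longrightarrow> (xsig D has_vector_derivative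
      pY D (xsig D t) *v theta D + pf D (xsig D t) + pg D (xsig D t) *v usig D t) (at t)"
    using traj by (simp add: plant_trajectory_def caratheodory_solution_def)
  moreover have "AE t in lborel. t > t0 \<longrightarrow> (zh has_vector_derivative zhat_rhs D th t (zh t)) (at t)"
    using zh by (simp add: caratheodory_solution_def)
  moreover have "AE t in lborel. t > t0 \<longrightarrow>
      (th has_vector_derivative thetahat_rhs D (\<lambda>t. zsig D t - zh t) G t (th t)) (at t)"
    using th by (simp add: caratheodory_solution_def)
  ultimately show "AE t in lborel. t0 < t \<longrightarrow> ((\<lambda>t. (zsig D t - zh t, theta D - th t)) has_vector_derivative
      error_rhs D (G t) t (zsig D t - zh t, theta D - th t)) (at t)"
  proof eventually_elim
    case (elim t)
    show ?case
    proof
      assume t: "t0 < t"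
      let ?x' = "pY D (xsig D t) *v theta D + pf D (xsig D t) + pg D (xsig D t) *v usig D t"
      let ?zt = "zsig D t - zh t"
      have "(zsig D has_vector_derivative Phi_z D t * (gradient (hfun D) (xsig D t) \<bullet> ?x')) (at t)"
        by (rule zsig_has_vector_derivative[OF h B traj]) (use elim t t0 in auto)
      then have "((\<lambda>t. (zsig D t - zh t, theta D - th t)) has_vector_derivative
          (Phi_z D t * (gradient (hfun D) (xsig D t) \<bullet> ?x') - zhat_rhs D th t (zh t),
           0 - thetahat_rhs D (\<lambda>t. zsig D t - zh t) G t (th t))) (at t)"
        using elim t
        by (intro has_vector_derivative_Pair has_vector_derivative_diff has_vector_derivative_const) auto
      \<comment> \<open>This is the argument of the projection in \<open>error_rhs\<close>. In the
        other component the drift f + g u is common to plant and observer and cancels.\<close>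
      moreover have "G t *v phi D t ?zt (th t) =
          k_theta D *\<^sub>R (G t *v (Sigma_Y D t *v (theta D - th t))) +
          (Phi_z D t * ?zt) *\<^sub>R (G t *v (transpose (pY D (xsig D t)) *v gradient (hfun D) (xsig D t)))"
        unfolding phi_eq[OF traj Y delay stack less_imp_le[OF le_less_trans[OF t0 t]]]
        by (simp add: matrix_vector_right_distrib matrix_vector_mult_scaleR)
      ultimately show "((\<lambda>t. (zsig D t - zh t, theta D - th t)) has_vector_derivative
          error_rhs D (G t) t (zsig D t - zh t, theta D - th t)) (at t)"
        by (simp add: error_rhs_def zhat_rhs_def thetahat_rhs_def matrix_vector_mult_diff_distrib
            inner_diff_right inner_add_right algebra_simps)
    qed
  qed
qed

text \<open>The error system is formulated on its own, with the gain as an auxiliary signal, so the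
  first conjunct is what ties its stability to the observer and the update law.\<close>

theorem theorem2:
  fixes D :: "('n::finite, 'm::finite, 'p::finite) adaptive_system"
    and G_bar sigma_theta :: real
  assumes h_C1: "C1_function (hfun D)"
    and barrier: "barrier_function (barB D)"
    and beta0_finite: "0 \<in> safe_interior (hfun D)"
    and trajectory: "plant_trajectory D"
    and delay: "delay D > 0"
    and kappa: "kappa D > 0"
    and delta: "delta D > 0"
    and stack: "history_stack D"
    and gains: "k_theta D > 0" "beta_theta D > 0" "gamma D > 0"
    and Gamma_bounds: "0 < Gamma_lo D" "Gamma_lo D \<le> Gamma_hi D"
    and A1: "locally_lipschitz (pf D)" "locally_lipschitz (pg D)" "locally_lipschitz (pY D)"
      "pf D 0 = 0" "pY D 0 = 0" "G_bar > 0"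
      "\<forall>x. 0 < matrix_norm (pg D x) \<and> matrix_norm (pg D x) \<le> G_bar"
    and A2: "theta_bar D > 0" "norm (theta D) \<le> theta_bar D"
    and A3: "safe_set (hfun D) \<noteq> {}"
      "\<forall>x\<in>safe_set (hfun D). x islimpt safe_set (hfun D)"
      "\<forall>x\<in>safe_boundary (hfun D). gradient (hfun D) x \<noteq> 0"
    and A4: "sigma_theta > 0"
      "\<exists>t1\<ge>0. filled D t1 = {1..slots D} \<and> lambda_min (Sigma_Y D t1) = sigma_theta"
    and gain_condition: "beta_theta D / (k_theta D * Gamma_hi D) > sigma_theta"
  shows "(\<forall>t0\<ge>0. \<forall>zh th G.
            caratheodory_solution t0 (zhat_rhs D th) zh \<and>
            caratheodory_solution t0 (thetahat_rhs D (\<lambda>t. zsig D t - zh t) G) th \<and>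
            Gamma_gain D t0 (\<lambda>t. zsig D t - zh t) th G \<longrightarrow>
            caratheodory_solution t0 (\<lambda>t. error_rhs D (G t) t)
              (\<lambda>t. (zsig D t - zh t, theta D - th t))) \<and>
         exponentially_stable (error_rhs D)
           (\<lambda>t0 G e. Gamma_gain D t0 (\<lambda>t. fst (e t)) (\<lambda>t. theta D - snd (e t)) G)"
proof (rule conjI)
  show "\<forall>t0\<ge>0. \<forall>zh th G.
            caratheodory_solution t0 (zhat_rhs D th) zh \<and>
            caratheodory_solution t0 (thetahat_rhs D (\<lambda>t. zsig D t - zh t) G) th \<and>
            Gamma_gain D t0 (\<lambda>t. zsig D t - zh t) th G \<longrightarrow>
            caratheodory_solution t0 (\<lambda>t. error_rhs D (G t) t)
              (\<lambda>t. (zsig D t - zh t, theta D - th t))"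
    using error_system_solution[OF h_C1 barrier trajectory A1(3) delay stack] by blast
  show "exponentially_stable (error_rhs D)
           (\<lambda>t0 G e. Gamma_gain D t0 (\<lambda>t. fst (e t)) (\<lambda>t. theta D - snd (e t)) G)"
    using error_system_exponentially_stable[OF kappa delta stack gains Gamma_bounds A2(2) A4(1)] A4(2)
    by blast
qed

end
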